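(* Let $\mathbb{G}$ be a homogeneous group of homogeneous dimension $Q$ and let $|\cdot|$ be an arbitrary homogeneous quasi-norm on $\mathbb{G}$. Let $1<p<q<\infty$ and $0<\lambda<Q$ satisfy $$\frac{1}{q}=\frac{1}{p}+\frac{\lambda}{Q}-1.$$ Then there is a positive constant $C$ such that for all $u\in L^{p}(\mathbb{G})$, $$\|I_{\lambda,|\cdot|}u\|_{L^{q}(\mathbb{G})}\leq C\,\|u\|_{L^{p}(\mathbb{G})},$$ where $C$ is independent of $u$ and $$I_{\lambda,|\cdot|}u(x)=\int_{\mathbb{G}}\frac{u(y)}{|y^{-1}x|^{\lambda}}\,dy .$$
   Context: A homogeneous (Lie) group $\mathbb{G}$ is a Lie group on $\mathbb{R}^{N}$ (i.e. with underlying manifold $\mathbb{R}^N$) equipped with dilations $D_{\lambda}:\mathbb{R}^{N}\to\mathbb{R}^{N}$, $D_{\lambda}(x):=(\lambda^{\nu_{1}}x_{1},\ldots,\lambda^{\nu_{N}}x_{N})$, with $\nu_{1},\ldots,\nu_{N}>0$, such that $D_{\lambda}$ is an automorphism of the group $\mathbb{G}$ for each $\lambda>0$. One writes $\lambda x$ for $D_{\lambda}(x)$. The identity element of $\mathbb{G}$ is $0$. The homogeneous dimension of $\mathbb{G}$ is $Q:=\nu_{1}+\cdots+\nu_{N}$. A homogeneous quasi-norm on $\mathbb{G}$ is a continuous non-negative function $\mathbb{G}\ni x\mapsto |x|\in[0,\infty)$ such that (i) $|x|=|x^{-1}|$ for all $x\in\mathbb{G}$; (ii) $|\lambda x|=\lambda|x|$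 for all $x\in\mathbb{G}$ and $\lambda>0$; (iii) $|x|=0$ if and only if $x=0$. Here $y^{-1}x$ denotes the product in $\mathbb{G}$ of the group inverse of $y$ with $x$; $dx$, $dy$ denote integration with respect to the Haar measure on $\mathbb{G}$, and $L^{p}(\mathbb{G})$ is the Lebesgue space with respect to this measure. *)

theory Defs
  imports "HOL-Analysis.Analysis" "HOL-Algebra.Group"
begin

text \<open>\<open>Ck k f\<close>: all iterated directional derivatives of \<open>f\<close> up to order \<open>k\<close> exist
  as Frechet derivatives and are continuous.\<close>

primrec Ck :: "nat \<Rightarrow> ('a::real_normed_vector \<Rightarrow> 'b::real_normed_vector) \<Rightarrow> bool" where
  "Ck 0 f \<longleftrightarrow> continuous_on UNIV f"
| "Ck (Suc k) f \<longleftrightarrow>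
     (\<forall>x. f differentiable (at x)) \<and> (\<forall>v. Ck k (\<lambda>x. frechet_derivative f (at x) v))"

definition smooth :: "('a::real_normed_vector \<Rightarrow> 'b::real_normed_vector) \<Rightarrow> bool" where
  "smooth f \<longleftrightarrow> (\<forall>k. Ck k f)"

locale lie_group_on_Rn = group G for G :: "(real^'n) monoid" (structure) +
  assumes carrier_UNIV: "carrier G = UNIV"
    and smooth_mult: "smooth (\<lambda>z. fst z \<otimes> snd z)"
    and smooth_inv: "smooth (\<lambda>x. inv x)"

definition dilation :: "real^'n \<Rightarrow> real \<Rightarrow> real^'n \<Rightarrow> real^'n" where
  "dilation \<nu> r x = (\<chi> i. r powr (\<nu> $ i) * x $ i)"

locale homogeneous_group = lie_group_on_Rn G for G :: "(real^'n) monoid" (structure) +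
  fixes \<nu> :: "real^'n"
  assumes weights_pos: "\<And>i. 0 < \<nu> $ i"
    and dilation_iso: "\<And>r. 0 < r \<Longrightarrow> dilation \<nu> r \<in> iso G G"

text \<open>That the identity element is the origin need not be assumed: the origin is the only
  common fixed point of the dilations.\<close>

lemma (in homogeneous_group) one_eq_0: "\<one> = 0"
proof -
  interpret hom: group_hom G G "dilation \<nu> 2"
    using dilation_iso[of 2] is_group by (simp add: group_hom_def group_hom_axioms_def iso_def)
  have "\<one> $ i = 0" for i
  proof -
    have "dilation \<nu> 2 \<one> $ i = \<one> $ i"
      by simp
    then have "(2 powr (\<nu> $ i) - 1) * \<one> $ i = 0"
      by (simp add: dilation_def algebra_simps)
    then show ?thesis
      using weights_pos[of i] by simp
  qed
  then show ?thesis
    by (simp add: vec_eq_iff)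
qed

definition homogeneous_dim :: "real^'n \<Rightarrow> real" where
  "homogeneous_dim \<nu> = (\<Sum>i\<in>UNIV. \<nu> $ i)"

definition homogeneous_quasi_norm ::
    "(real^'n) monoid \<Rightarrow> real^'n \<Rightarrow> (real^'n \<Rightarrow> real) \<Rightarrow> bool" where
  "homogeneous_quasi_norm G \<nu> N \<longleftrightarrow>
     continuous_on UNIV N \<and> (\<forall>x. 0 \<le> N x) \<and>
     (\<forall>x. N x = N (inv\<^bsub>G\<^esub> x)) \<and>
     (\<forall>x r. 0 < r \<longrightarrow> N (dilation \<nu> r x) = r * N x) \<and>
     (\<forall>x. N x = 0 \<longleftrightarrow> x = 0)"

text \<open>A left Haar measure, as a Borel measure. Regularity is not listed, since Borel measures on
  \<open>real^'n\<close> that are finite on compact sets are regular.\<close>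

definition haar_measure :: "(real^'n) monoid \<Rightarrow> (real^'n) measure \<Rightarrow> bool" where
  "haar_measure G \<mu> \<longleftrightarrow>
     sets \<mu> = sets borel \<and>
     emeasure \<mu> UNIV \<noteq> 0 \<and>
     (\<forall>K. compact K \<longrightarrow> emeasure \<mu> K < \<infinity>) \<and>
     (\<forall>x\<in>carrier G. \<forall>A\<in>sets \<mu>. emeasure \<mu> ((\<lambda>y. x \<otimes>\<^bsub>G\<^esub> y) ` A) = emeasure \<mu> A)"

text \<open>The elements of \<open>Lp \<mu> p\<close> are functions, not classes modulo null sets.\<close>

definition Lp :: "'a measure \<Rightarrow> real \<Rightarrow> ('a \<Rightarrow> complex) set" where
  "Lp \<mu> p = {f \<in> borel_measurable \<mu>. integrable \<mu> (\<lambda>x. norm (f x) powr p)}"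

definition Lp_norm :: "'a measure \<Rightarrow> real \<Rightarrow> ('a \<Rightarrow> complex) \<Rightarrow> real" where
  "Lp_norm \<mu> p f = (\<integral>x. norm (f x) powr p \<partial>\<mu>) powr (1 / p)"

definition riesz_integrand ::
    "(real^'n) monoid \<Rightarrow> (real^'n \<Rightarrow> real) \<Rightarrow> real \<Rightarrow> (real^'n \<Rightarrow> complex) \<Rightarrow> real^'n \<Rightarrow> real^'n \<Rightarrow> complex"
  where "riesz_integrand G N l u x y = u y / complex_of_real (N (inv\<^bsub>G\<^esub> y \<otimes>\<^bsub>G\<^esub> x) powr l)"

text \<open>The integral is Bochner's, hence \<open>0\<close> at points \<open>x\<close> where the integrand is not integrable;
  its almost everywhere convergence has to be stated separately.\<close>

definition riesz_potential ::
    "(real^'n) monoid \<Rightarrow> (real^'n) measure \<Rightarrow> (real^'n \<Rightarrow> real) \<Rightarrow> real \<Rightarrow> (real^'n \<Rightarrow> complex)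
      \<Rightarrow> real^'n \<Rightarrow> complex"
  where "riesz_potential G \<mu> N l u x = (\<integral>y. riesz_integrand G N l u x y \<partial>\<mu>)"

end

theory Submission imports Defs
begin

text \<open>The kernel is the power \<open>c\<^sup>\<gamma>\<close>, \<open>\<gamma> = \<lambda> / Q\<close>, of the symmetric function
  \<open>c(x, y) = |x\<^sup>-\<^sup>1 y|\<^sup>-\<^sup>Q\<close>, which is uniformly of weak type \<open>L\<^sup>1\<close> in each variable because quasi-balls
  of radius \<open>r\<close> have measure \<open>O(r\<^sup>Q)\<close>. By duality it suffices to bound the integral of
  \<open>a(y)\<^sup>\<alpha> b(x)\<^sup>\<beta> c(x, y)\<^sup>\<gamma>\<close>, where \<open>a = |u|\<^sup>p\<close> and \<open>b\<close> are normalised in \<open>L\<^sup>1\<close> and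
  \<open>\<alpha> = 1 / p\<close>, \<open>\<beta> = 1 - 1 / q\<close>, so that \<open>\<alpha> + \<beta> + \<gamma> = 2\<close>. As the exponents lie in \<open>(0, 1)\<close>,
  the integrand is at most
  \<open>a b + a c min(a/c, c/a)\<^sup>\<epsilon> + b c min(b/c, c/b)\<^sup>\<epsilon>\<close>, and the integral of
  \<open>c min(s/c, c/s)\<^sup>\<epsilon>\<close> in one variable is bounded uniformly in \<open>s\<close>, by a dyadic decomposition.

  For the volume of quasi-balls, the Jacobian at \<open>0\<close> of the left translation by \<open>x\<close> is continuous in
  \<open>x\<close> and invariant under the dilations of \<open>x\<close>, hence identically \<open>1\<close>. So Lebesgue measure is a
  left Haar measure, and it scales by \<open>r\<^sup>Q\<close>; any other Haar measure is compared with it by Fubini.\<close>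

section \<open>Kernels of weak type\<close>

text \<open>In logarithmic coordinates, the summand that omits the smallest of \<open>a\<close>,
  \<open>b\<close>, \<open>c\<close> already dominates. Since the exponents sum to 2, the logarithm
  of the left side is the sum of the two larger logarithms minus their distances to the smallest
  one, each weighted by 1 minus the corresponding exponent, hence by at least \<open>e\<close>. The
  two distances add up to at least the gap between the larger logarithms, which pays for the factor
  \<open>min ... powr e\<close>.\<close>

lemma young_three:
  fixes a b c \<alpha> \<beta> \<gamma> e :: real
  assumes "0 \<le> a" "0 \<le> b" "0 \<le> c"
    and sum: "\<alpha> + \<beta> + \<gamma> = 2"
    and e: "0 \<le> e" "e \<le> 1 - \<alpha>" "e \<le> 1 - \<beta>" "e \<le> 1 - \<gamma>"
  shows "a powr \<alpha> * b powr \<beta> * c powr \<gamma>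
    \<le> a * b + a * (c * min (a / c) (c / a) powr e) + b * (c * min (b / c) (c / b) powr e)"
proof (cases "a = 0 \<or> b = 0 \<or> c = 0")
  \<comment> \<open>\<open>0 powr t = 0\<close> for every \<open>t\<close>, so the left side
    vanishes.\<close>
  case True
  then show ?thesis using assms by auto
next
  case False
  then have pos: "0 < a" "0 < b" "0 < c" using assms by auto
  define A B C where "A = ln a" and "B = ln b" and "C = ln c"
  have abc: "a = exp A" "b = exp B" "c = exp C"
    using pos by (auto simp: A_def B_def C_def)
  have min_exp: "min (exp s / exp t) (exp t / exp s) powr e = exp (- e * \<bar>s - t\<bar>)" for s t :: real
    by (cases "s \<le> t") (auto simp: min_def exp_diff[symmetric] powr_def abs_if algebra_simps)
  have lhs: "a powr \<alpha> * b powr \<beta> * c powr \<gamma> = exp (\<alpha> * A + \<beta> * B + \<gamma> * C)"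
    by (simp add: abc powr_def exp_add)
  have t1: "a * b = exp (A + B)" by (simp add: abc exp_add)
  have t2: "a * (c * min (a / c) (c / a) powr e) = exp (A + C - e * \<bar>A - C\<bar>)"
    unfolding abc min_exp by (simp add: exp_add[symmetric])
  have t3: "b * (c * min (b / c) (c / b) powr e) = exp (B + C - e * \<bar>B - C\<bar>)"
    unfolding abc min_exp by (simp add: exp_add[symmetric])
  \<comment> \<open>Stated for arbitrary logarithms and first two exponents, because it is used
    twice, the second time with the roles of \<open>a\<close> and \<open>b\<close>
    interchanged.\<close>
  have key: "\<alpha>' * A + \<beta>' * B + \<gamma> * C \<le> A + C - e * \<bar>A - C\<bar>"
    if "\<alpha>' + \<beta>' + \<gamma> = 2" "e \<le> 1 - \<alpha>'" "B \<le> A" "B \<le> C" for \<alpha>' \<beta>' A B C :: real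
  proof -
    have "e * \<bar>A - C\<bar> \<le> e * ((A - B) + (C - B))"
      using that e by (intro mult_left_mono) auto
    also have "\<dots> = e * (A - B) + e * (C - B)" by (simp add: algebra_simps)
    also have "\<dots> \<le> (1 - \<alpha>') * (A - B) + (1 - \<gamma>) * (C - B)"
      using that e by (intro add_mono mult_right_mono) auto
    finally have "e * \<bar>A - C\<bar> \<le> (1 - \<alpha>') * (A - B) + (1 - \<gamma>) * (C - B)" .
    moreover have \<beta>': "\<beta>' = 2 - \<alpha>' - \<gamma>" using that by simp
    ultimately show ?thesis unfolding \<beta>' by (simp add: algebra_simps)
  qed
  consider "C \<le> A" "C \<le> B" | "B \<le> A" "B \<le> C" | "A \<le> B" "A \<le> C" by linarith
  then show ?thesis
  proof cases
    case 1
    have "(1 - \<alpha>) * A + (1 - \<beta>) * B \<ge> (1 - \<alpha>) * C + (1 - \<beta>) * C"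
      using 1 e by (intro add_mono mult_left_mono) auto
    moreover have \<gamma>: "\<gamma> = 2 - \<alpha> - \<beta>" using sum by simp
    ultimately have "\<alpha> * A + \<beta> * B + \<gamma> * C \<le> A + B" unfolding \<gamma> by (simp add: algebra_simps)
    then show ?thesis unfolding lhs t1 t2 t3 by (smt (verit) exp_ge_zero exp_le_cancel_iff)
  next
    case 2
    have "\<alpha> * A + \<beta> * B + \<gamma> * C \<le> A + C - e * \<bar>A - C\<bar>"
      using key[of \<alpha> \<beta> B A C] 2 sum e by simp
    then show ?thesis unfolding lhs t1 t2 t3 by (smt (verit) exp_ge_zero exp_le_cancel_iff)
  next
    case 3
    have "\<alpha> * A + \<beta> * B + \<gamma> * C \<le> B + C - e * \<bar>B - C\<bar>"
      using key[of \<beta> \<alpha> A B C] 3 sum e by simp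
    then show ?thesis unfolding lhs t1 t2 t3 by (smt (verit) exp_ge_zero exp_le_cancel_iff)
  qed
qed

lemma nat_bracket_two_power:
  fixes s :: real
  assumes "1 \<le> s"
  obtains k :: nat where "2 ^ k \<le> s" "s < 2 ^ Suc k"
proof -
  have ex: "\<exists>n. s < 2 ^ n" using real_arch_pow[of 2 s] by auto
  define n where "n = (LEAST n. s < (2::real) ^ n)"
  have n: "s < 2 ^ n" unfolding n_def using ex by (rule LeastI_ex)
  then obtain k where k: "n = Suc k" using assms by (cases n) auto
  have "\<not> s < 2 ^ k" unfolding n_def[symmetric]
    using not_less_Least[of k "\<lambda>n. s < (2::real)^n"] k n_def by auto
  then show ?thesis using that[of k] n k by auto
qed

text \<open>Cut the range of \<open>g\<close> into dyadic layers around the level \<open>a\<close>.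
  On the layer at height about \<open>2 ^ k * a\<close> the integrand is at most
  \<open>2 * 2 ^ k * a * \<theta> ^ k\<close> with \<open>\<theta> = 2 powr - e\<close>, and the
  weak bound gives measure at most \<open>A / (2 ^ k * a)\<close>, so the layer contributes
  \<open>2 * A * \<theta> ^ k\<close>. The layers below \<open>a\<close> behave alike. The level
  cancels, which makes the geometric sum uniform in \<open>a\<close>.\<close>

lemma weak_L1_truncated_bound:
  fixes M :: "'a measure" and g :: "'a \<Rightarrow> real"
  assumes g[measurable]: "g \<in> borel_measurable M" and nonneg: "\<And>y. 0 \<le> g y"
    and A: "0 \<le> A" and weak: "\<And>t. 0 < t \<Longrightarrow> emeasure M {y \<in> space M. t \<le> g y} \<le> ennreal (A / t)"
    and e: "0 < e" and a: "0 \<le> a"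
  shows "(\<integral>\<^sup>+y. ennreal (g y * min (a / g y) (g y / a) powr e) \<partial>M)
    \<le> ennreal (4 * A / (1 - 2 powr - e))"
proof (cases "a = 0")
  \<comment> \<open>Division by zero gives \<open>g y / 0 = 0\<close>, so the minimum and its power
    vanish.\<close>
  case True
  then have "(\<integral>\<^sup>+y. ennreal (g y * min (a / g y) (g y / a) powr e) \<partial>M) = 0"
    using nonneg by (simp add: min_def)
  then show ?thesis by simp
next
  case False
  then have a: "0 < a" using a by simp
  define \<theta> where "\<theta> = 2 powr - e"
  have \<theta>: "0 < \<theta>" "\<theta> < 1" using e by (auto simp: \<theta>_def powr_minus inverse_less_1_iff)
  have \<theta>k: "(1 / 2 ^ k) powr e = \<theta> ^ k" for k :: nat
    by (simp add: \<theta>_def powr_divide powr_minus_divide power_divide powr_powr powr_realpow[symmetric] 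
       mult.commute)
  \<comment> \<open>Term \<open>k\<close> serves the \<open>k\<close>-th layer above
    \<open>a\<close> and the \<open>k\<close>-th layer below it. Each layer is enlarged to the full
    superlevel set of its lower endpoint, to which \<open>weak\<close> applies; the coefficient
    contains twice that endpoint.\<close>
  define F where "F k y = ennreal (2 * 2 ^ k * a * \<theta> ^ k) * indicator {y \<in> space M. 2 ^ k * a \<le> g y} y
     + ennreal (2 / 2 ^ Suc k * a * \<theta> ^ k) * indicator {y \<in> space M. a / 2 ^ Suc k \<le> g y} y" for k y
  have [measurable]: "F k \<in> borel_measurable M" for k unfolding F_def by measurable
  have bound: "ennreal (g y * min (a / g y) (g y / a) powr e) \<le> (\<Sum>k. F k y)" if y: "y \<in> space M" for y
  proof -
    have single: "F k y \<le> (\<Sum>k. F k y)" for k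
      using sum_le_suminf[of "\<lambda>k. F k y" "{k}"] by simp
    consider "g y = 0" | "a \<le> g y" | "0 < g y" "g y < a" using nonneg[of y] by linarith
    then show ?thesis
    proof cases
      case 1
      then show ?thesis by simp
    next
      case 2
      then obtain k where k: "2 ^ k \<le> g y / a" "g y / a < 2 ^ Suc k"
        using nat_bracket_two_power[of "g y / a"] a by auto
      have gy: "0 < g y" using 2 a by simp
      have "min (a / g y) (g y / a) \<le> 1 / 2 ^ k"
        using k a gy by (intro min.coboundedI1) (simp add: field_simps)
      then have "min (a / g y) (g y / a) powr e \<le> (1 / 2 ^ k) powr e"
        using e a gy by (intro powr_mono2) auto
      moreover have "g y \<le> 2 * 2 ^ k * a" using k a by (simp add: field_simps)
      ultimately have "g y * min (a / g y) (g y / a) powr e \<le> 2 * 2 ^ k * a * \<theta> ^ k"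
        unfolding \<theta>k using nonneg \<theta> a by (intro mult_mono) auto
      moreover have "2 ^ k * a \<le> g y" using k a by (simp add: field_simps)
      ultimately have "ennreal (g y * min (a / g y) (g y / a) powr e) \<le> F k y"
        using y by (auto simp: F_def intro!: add_increasing2 ennreal_leI)
      then show ?thesis using single order_trans by blast
    next
      case 3
      then obtain k where k: "2 ^ k \<le> a / g y" "a / g y < 2 ^ Suc k"
        using nat_bracket_two_power[of "a / g y"] a by auto
      have "min (a / g y) (g y / a) \<le> 1 / 2 ^ k"
        using k a 3 by (intro min.coboundedI2) (simp add: field_simps)
      then have "min (a / g y) (g y / a) powr e \<le> (1 / 2 ^ k) powr e"
        using e a 3 by (intro powr_mono2) auto
      moreover have "g y \<le> 2 / 2 ^ Suc k * a" using k 3 a by (simp add: field_simps)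
      ultimately have "g y * min (a / g y) (g y / a) powr e \<le> 2 / 2 ^ Suc k * a * \<theta> ^ k"
        unfolding \<theta>k using nonneg \<theta> a by (intro mult_mono) auto
      moreover have "a / 2 ^ Suc k \<le> g y" using k 3 a by (simp add: field_simps)
      ultimately have "ennreal (g y * min (a / g y) (g y / a) powr e) \<le> F k y"
        using y by (auto simp: F_def intro!: add_increasing ennreal_leI)
      then show ?thesis using single order_trans by blast
    qed
  qed
  have Fk: "(\<integral>\<^sup>+y. F k y \<partial>M) \<le> ennreal (4 * A * \<theta> ^ k)" for k
  proof -
    have "(\<integral>\<^sup>+y. F k y \<partial>M) = ennreal (2 * 2 ^ k * a * \<theta> ^ k) * emeasure M {y \<in> space M. 2 ^ k * a \<le> g y}
      + ennreal (2 / 2 ^ Suc k * a * \<theta> ^ k) * emeasure M {y \<in> space M. a / 2 ^ Suc k \<le> g y}"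
      unfolding F_def by (subst nn_integral_add) (auto simp: nn_integral_cmult_indicator)
    also have "\<dots> \<le> ennreal (2 * 2 ^ k * a * \<theta> ^ k) * ennreal (A / (2 ^ k * a))
      + ennreal (2 / 2 ^ Suc k * a * \<theta> ^ k) * ennreal (A / (a / 2 ^ Suc k))"
      using a by (intro add_mono mult_left_mono weak) auto
    also have "\<dots> = ennreal (4 * A * \<theta> ^ k)"
      using a A \<theta> by (subst (1 2) ennreal_mult[symmetric], simp_all, subst ennreal_plus[symmetric])
        (auto simp del: ennreal_plus simp: field_simps)
    finally show ?thesis .
  qed
  have "(\<integral>\<^sup>+y. ennreal (g y * min (a / g y) (g y / a) powr e) \<partial>M) \<le> (\<integral>\<^sup>+y. (\<Sum>k. F k y) \<partial>M)"
    by (intro nn_integral_mono bound)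
  also have "\<dots> = (\<Sum>k. \<integral>\<^sup>+y. F k y \<partial>M)" by (rule nn_integral_suminf) auto
  also have "\<dots> \<le> (\<Sum>k. ennreal (4 * A * \<theta> ^ k))" by (intro suminf_le Fk) auto
  also have "\<dots> = ennreal (4 * A * (1 / (1 - \<theta>)))"
    using A \<theta> by (intro suminf_ennreal_eq sums_mult geometric_sums) auto
  finally show ?thesis by (simp add: \<theta>_def)
qed

section \<open>Integral operators with kernels of weak type\<close>

text \<open>Integrate \<open>young_three\<close>. The term \<open>a b\<close> contributes at most 1.
  In the other two terms, integrate first in the variable on which the weight \<open>a\<close> or
  \<open>b\<close> does not depend: there the weight is a fixed level, and
  \<open>weak_L1_truncated_bound\<close> is uniform in the level. For the term with \<open>a\<close>
  this requires an exchange of the integrals.\<close>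

lemma weak_type_bilinear_bound:
  fixes M :: "'a measure" and c :: "'a \<Rightarrow> 'a \<Rightarrow> real"
  assumes "sigma_finite_measure M"
    and c [measurable]: "(\<lambda>(x, y). c x y) \<in> borel_measurable (M \<Otimes>\<^sub>M M)"
    and c_nonneg: "\<And>x y. 0 \<le> c x y"
    and A: "0 \<le> A"
    and row: "\<And>x t. x \<in> space M \<Longrightarrow> 0 < t \<Longrightarrow> emeasure M {y \<in> space M. t \<le> c x y} \<le> ennreal (A / t)"
    and col: "\<And>y t. y \<in> space M \<Longrightarrow> 0 < t \<Longrightarrow> emeasure M {x \<in> space M. t \<le> c x y} \<le> ennreal (A / t)"
    and sum: "\<alpha> + \<beta> + \<gamma> = 2"
    and e: "0 < e" "e \<le> 1 - \<alpha>" "e \<le> 1 - \<beta>" "e \<le> 1 - \<gamma>"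
    and a [measurable]: "a \<in> borel_measurable M" and a_nonneg: "\<And>x. 0 \<le> a x" and a1: "(\<integral>\<^sup>+x. ennreal (a x) \<partial>M) \<le> 1"
    and b [measurable]: "b \<in> borel_measurable M" and b_nonneg: "\<And>x. 0 \<le> b x" and b1: "(\<integral>\<^sup>+x. ennreal (b x) \<partial>M) \<le> 1"
  shows "(\<integral>\<^sup>+x. \<integral>\<^sup>+y. ennreal (a y powr \<alpha> * b x powr \<beta> * c x y powr \<gamma>) \<partial>M \<partial>M)
    \<le> ennreal (1 + 8 * A / (1 - 2 powr - e))"
proof -
  interpret sigma_finite_measure M by fact
  interpret MM: pair_sigma_finite M M ..
  define D where "D = 4 * A / (1 - 2 powr - e)"
  have "2 powr - e < 1" using e by (simp add: powr_minus inverse_less_1_iff)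
  then have D: "0 \<le> D" using A by (simp add: D_def)
  define m where "m s t = t * min (s / t) (t / s) powr e" for s t :: real
  have m_nonneg: "0 \<le> t \<Longrightarrow> 0 \<le> m s t" for s t by (simp add: m_def)
  have [measurable]: "(\<lambda>x. m (f x) (g x)) \<in> borel_measurable K"
    if [measurable]: "f \<in> borel_measurable K" "g \<in> borel_measurable K" for f g and K :: "'b measure"
    unfolding m_def by measurable
  have [measurable]: "(\<lambda>y. c x y) \<in> borel_measurable M" if "x \<in> space M" for x
    using measurable_compose[OF measurable_Pair1'[OF that] c] by simp
  have [measurable]: "(\<lambda>x. c x y) \<in> borel_measurable M" if "y \<in> space M" for y
    using measurable_compose[OF measurable_Pair2'[OF that] c] by simp
  have row_m: "(\<integral>\<^sup>+y. ennreal (m s (c x y)) \<partial>M) \<le> ennreal D" if x: "x \<in> space M" and s: "0 \<le> s" for x s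
    unfolding m_def D_def
    by (rule weak_L1_truncated_bound) (use x s in \<open>simp_all add: c_nonneg A row e\<close>)
  have col_m: "(\<integral>\<^sup>+x. ennreal (m s (c x y)) \<partial>M) \<le> ennreal D" if y: "y \<in> space M" and s: "0 \<le> s" for y s
    unfolding m_def D_def
    by (rule weak_L1_truncated_bound) (use y s in \<open>simp_all add: c_nonneg A col e\<close>)
  have 1: "(\<integral>\<^sup>+x. \<integral>\<^sup>+y. ennreal (a y) * ennreal (b x) \<partial>M \<partial>M) \<le> 1"
  proof -
    have "(\<integral>\<^sup>+x. \<integral>\<^sup>+y. ennreal (a y) * ennreal (b x) \<partial>M \<partial>M)
        = (\<integral>\<^sup>+y. ennreal (a y) \<partial>M) * (\<integral>\<^sup>+x. ennreal (b x) \<partial>M)"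
      by (simp add: nn_integral_multc nn_integral_cmult)
    also have "\<dots> \<le> 1 * 1" by (intro mult_mono a1 b1) auto
    finally show ?thesis by simp
  qed
  have 2: "(\<integral>\<^sup>+x. \<integral>\<^sup>+y. ennreal (a y) * ennreal (m (a y) (c x y)) \<partial>M \<partial>M) \<le> ennreal D"
  proof -
    have "(\<integral>\<^sup>+x. \<integral>\<^sup>+y. ennreal (a y) * ennreal (m (a y) (c x y)) \<partial>M \<partial>M)
        = (\<integral>\<^sup>+y. \<integral>\<^sup>+x. ennreal (a y) * ennreal (m (a y) (c x y)) \<partial>M \<partial>M)"
      by (rule MM.Fubini') measurable
    also have "\<dots> = (\<integral>\<^sup>+y. ennreal (a y) * (\<integral>\<^sup>+x. ennreal (m (a y) (c x y)) \<partial>M) \<partial>M)"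
      by (intro nn_integral_cong nn_integral_cmult) measurable
    also have "\<dots> \<le> (\<integral>\<^sup>+y. ennreal (a y) * ennreal D \<partial>M)"
      by (intro nn_integral_mono mult_left_mono col_m) (auto simp: a_nonneg)
    also have "\<dots> \<le> 1 * ennreal D"
      using mult_right_mono[OF a1, of "ennreal D"] by (simp add: nn_integral_multc)
    finally show ?thesis by simp
  qed
  have 3: "(\<integral>\<^sup>+x. \<integral>\<^sup>+y. ennreal (b x) * ennreal (m (b x) (c x y)) \<partial>M \<partial>M) \<le> ennreal D"
  proof -
    have "(\<integral>\<^sup>+x. \<integral>\<^sup>+y. ennreal (b x) * ennreal (m (b x) (c x y)) \<partial>M \<partial>M)
        = (\<integral>\<^sup>+x. ennreal (b x) * (\<integral>\<^sup>+y. ennreal (m (b x) (c x y)) \<partial>M) \<partial>M)"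
      by (intro nn_integral_cong nn_integral_cmult) measurable
    also have "\<dots> \<le> (\<integral>\<^sup>+x. ennreal (b x) * ennreal D \<partial>M)"
      by (intro nn_integral_mono mult_left_mono row_m) (auto simp: b_nonneg)
    also have "\<dots> \<le> 1 * ennreal D"
      using mult_right_mono[OF b1, of "ennreal D"] by (simp add: nn_integral_multc)
    finally show ?thesis by simp
  qed
  have "(\<integral>\<^sup>+x. \<integral>\<^sup>+y. ennreal (a y powr \<alpha> * b x powr \<beta> * c x y powr \<gamma>) \<partial>M \<partial>M)
    \<le> (\<integral>\<^sup>+x. \<integral>\<^sup>+y. (ennreal (a y) * ennreal (b x) + ennreal (a y) * ennreal (m (a y) (c x y)))
        + ennreal (b x) * ennreal (m (b x) (c x y)) \<partial>M \<partial>M)"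
  proof (intro nn_integral_mono)
    fix x y
    have "a y powr \<alpha> * b x powr \<beta> * c x y powr \<gamma>
      \<le> a y * b x + a y * m (a y) (c x y) + b x * m (b x) (c x y)"
      unfolding m_def
      by (rule young_three) (use sum e in \<open>auto simp: a_nonneg b_nonneg c_nonneg\<close>)
    then show "ennreal (a y powr \<alpha> * b x powr \<beta> * c x y powr \<gamma>)
      \<le> (ennreal (a y) * ennreal (b x) + ennreal (a y) * ennreal (m (a y) (c x y)))
        + ennreal (b x) * ennreal (m (b x) (c x y))"
      by (simp add: ennreal_mult[symmetric] a_nonneg b_nonneg c_nonneg m_nonneg ennreal_leI
          flip: ennreal_plus)
  qed
  also have "\<dots> = (\<integral>\<^sup>+x. \<integral>\<^sup>+y. ennreal (a y) * ennreal (b x) \<partial>M \<partial>M)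
     + (\<integral>\<^sup>+x. \<integral>\<^sup>+y. ennreal (a y) * ennreal (m (a y) (c x y)) \<partial>M \<partial>M)
     + (\<integral>\<^sup>+x. \<integral>\<^sup>+y. ennreal (b x) * ennreal (m (b x) (c x y)) \<partial>M \<partial>M)"
    by (simp add: nn_integral_add cong: nn_integral_cong)
  also have "\<dots> \<le> 1 + ennreal D + ennreal D"
    by (intro add_mono 1 2 3)
  also have "\<dots> = ennreal (1 + 8 * A / (1 - 2 powr - e))"
    using D by (simp add: D_def flip: ennreal_plus ennreal_1)
  finally show ?thesis .
qed

text \<open>Duality with the extremal test function: for a truncation \<open>g\<close> of
  \<open>T f\<close>, the integral \<open>S\<close> of \<open>g powr q\<close> is at most that of
  \<open>T f * g powr (q - 1)\<close>, so the bilinear bound yields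
  \<open>S \<le> E * P powr (1 / p) * S powr (1 - 1 / q)\<close>, and the power of \<open>S\<close>
  cancels. Finiteness almost everywhere is part of the conclusion because \<open>enn2real\<close>
  sends infinity to 0. An upper bound \<open>P > 0\<close> replaces the integral of
  \<open>f powr p\<close>, which may be 0, so that one can divide by it.\<close>

lemma weak_type_strong_bound:
  fixes M :: "'a measure" and c :: "'a \<Rightarrow> 'a \<Rightarrow> real" and A p q \<gamma> :: real
  assumes "sigma_finite_measure M"
    and c [measurable]: "(\<lambda>(x, y). c x y) \<in> borel_measurable (M \<Otimes>\<^sub>M M)"
    and c_nonneg: "\<And>x y. 0 \<le> c x y"
    and A: "0 \<le> A"
    and row: "\<And>x t. x \<in> space M \<Longrightarrow> 0 < t \<Longrightarrow> emeasure M {y \<in> space M. t \<le> c x y} \<le> ennreal (A / t)"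
    and col: "\<And>y t. y \<in> space M \<Longrightarrow> 0 < t \<Longrightarrow> emeasure M {x \<in> space M. t \<le> c x y} \<le> ennreal (A / t)"
    and p: "1 < p" and q: "1 < q" and \<gamma>: "\<gamma> < 1" and pq: "1 / q = 1 / p + \<gamma> - 1"
  obtains C where "0 \<le> C"
    and "\<And>f P. f \<in> borel_measurable M \<Longrightarrow> (\<And>y. 0 \<le> f y) \<Longrightarrow> 0 < P \<Longrightarrow>
      (\<integral>\<^sup>+y. ennreal (f y powr p) \<partial>M) \<le> ennreal P \<Longrightarrow>
      (AE x in M. (\<integral>\<^sup>+y. ennreal (f y * c x y powr \<gamma>) \<partial>M) < \<infinity>) \<and>
      (\<integral>\<^sup>+x. ennreal (enn2real (\<integral>\<^sup>+y. ennreal (f y * c x y powr \<gamma>) \<partial>M) powr q) \<partial>M)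
        \<le> ennreal (C * P powr (q / p))"
proof -
  interpret sigma_finite_measure M by fact
  \<comment> \<open>The largest \<open>e\<close> that \<open>weak_type_bilinear_bound\<close> admits
    for the exponents \<open>1 / p\<close>, \<open>1 - 1 / q\<close> and
    \<open>\<gamma>\<close>.\<close>
  define e where "e = min (1 - 1 / p) (min (1 / q) (1 - \<gamma>))"
  have e: "0 < e" "e \<le> 1 - 1 / p" "e \<le> 1 - (1 - 1 / q)" "e \<le> 1 - \<gamma>"
    using p q \<gamma> by (auto simp: e_def)
  define E where "E = 1 + 8 * A / (1 - 2 powr - e)"
  have "2 powr - e < 1" using e by (simp add: powr_minus inverse_less_1_iff)
  then have E: "0 < E" using A by (auto simp: E_def intro!: add_pos_nonneg)
  show thesis
  proof (rule that[of "E powr q"])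
    show "0 \<le> E powr q" by simp
    fix f :: "'a \<Rightarrow> real" and P :: real
    assume f [measurable]: "f \<in> borel_measurable M" and f_nonneg: "\<And>y. 0 \<le> f y" and P: "0 < P"
      and fP: "(\<integral>\<^sup>+y. ennreal (f y powr p) \<partial>M) \<le> ennreal P"
    define T where "T x = (\<integral>\<^sup>+y. ennreal (f y * c x y powr \<gamma>) \<partial>M)" for x
    have T [measurable]: "T \<in> borel_measurable M"
      unfolding T_def by measurable
    obtain B :: "nat \<Rightarrow> 'a set" where B: "range B \<subseteq> sets M" "(\<Union>i. B i) = space M"
        "\<And>i. emeasure M (B i) \<noteq> \<infinity>" "incseq B"
      using sigma_finite_incseq by blast
    have [measurable]: "B k \<in> sets M" for k using B by auto
    \<comment> \<open>Truncation in height and to a set of finite measure makes the integral of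
      \<open>g k powr q\<close> finite, so that it can be cancelled below.\<close>
    define g where "g k x = enn2real (min (T x) (of_nat k)) * indicator (B k) x" for k x
    have [measurable]: "g k \<in> borel_measurable M" for k unfolding g_def by measurable
    have g_nonneg: "0 \<le> g k x" for k x by (simp add: g_def)
    have min_fin: "min (T x) (of_nat k) < (\<infinity> :: ennreal)" for x k by (simp add: min_less_iff_disj ennreal_of_nat_eq_real_of_nat)
    have g_le: "ennreal (g k x) \<le> T x" for k x
      using min_fin[of x k] by (auto simp: g_def indicator_def)
    have g_le_k: "g k x \<le> of_nat k * indicator (B k) x" for k x
    proof -
      have "enn2real (min (T x) (of_nat k)) \<le> enn2real (of_nat k)"
        by (rule enn2real_mono) (auto simp: ennreal_of_nat_eq_real_of_nat)
      then show ?thesis by (simp add: g_def indicator_def)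
    qed
    define K where "K = E powr q * P powr (q / p)"
    have gK: "(\<integral>\<^sup>+x. ennreal (g k x powr q) \<partial>M) \<le> ennreal K" for k
    proof -
      have "(\<integral>\<^sup>+x. ennreal (g k x powr q) \<partial>M) \<le> (\<integral>\<^sup>+x. ennreal (of_nat k powr q) * indicator (B k) x \<partial>M)"
      proof (intro nn_integral_mono)
        fix x
        have "g k x powr q \<le> (of_nat k * indicator (B k) x) powr q"
          using q g_nonneg g_le_k by (intro powr_mono2) auto
        then show "ennreal (g k x powr q) \<le> ennreal (of_nat k powr q) * indicator (B k) x"
          by (auto simp: indicator_def intro!: ennreal_leI)
      qed
      also have "\<dots> < \<infinity>"
        using B(3)[of k] by (simp add: nn_integral_cmult_indicator ennreal_mult_less_top less_top)
      finally obtain S where S: "0 \<le> S" "(\<integral>\<^sup>+x. ennreal (g k x powr q) \<partial>M) = ennreal S"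
        by (cases "\<integral>\<^sup>+x. ennreal (g k x powr q) \<partial>M") auto
      show ?thesis
      proof (cases "S = 0")
        case True
        then show ?thesis using S by simp
      next
        case False
        then have S0: "0 < S" using S by simp
        define a where "a y = f y powr p / P" for y
        define b where "b x = g k x powr q / S" for x
        have bil: "(\<integral>\<^sup>+x. \<integral>\<^sup>+y. ennreal (a y powr (1 / p) * b x powr (1 - 1 / q) * c x y powr \<gamma>) \<partial>M \<partial>M)
          \<le> ennreal E"
          unfolding E_def
        proof (rule weak_type_bilinear_bound[OF \<open>sigma_finite_measure M\<close> c c_nonneg A row col])
          have "(\<integral>\<^sup>+x. ennreal (a x) \<partial>M) = (\<integral>\<^sup>+x. ennreal (f x powr p) \<partial>M) / ennreal P"
            unfolding a_def using P by (subst nn_integral_divide[symmetric]) (auto simp: divide_ennreal)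
          also have "\<dots> \<le> ennreal P / ennreal P" by (intro divide_right_mono_ennreal fP)
          finally show "(\<integral>\<^sup>+x. ennreal (a x) \<partial>M) \<le> 1" using P by (simp add: divide_ennreal)
          have "(\<integral>\<^sup>+x. ennreal (b x) \<partial>M) = (\<integral>\<^sup>+x. ennreal (g k x powr q) \<partial>M) / ennreal S"
            unfolding b_def using S0 by (subst nn_integral_divide[symmetric]) (auto simp: divide_ennreal)
          then show "(\<integral>\<^sup>+x. ennreal (b x) \<partial>M) \<le> 1" using S0 by (simp add: S divide_ennreal)
        qed (use pq e P S0 in \<open>auto simp: a_def b_def\<close>)
        \<comment> \<open>\<open>L\<close> undoes the normalisations of \<open>f\<close> and of
          \<open>g k powr (q - 1)\<close>.\<close>
        define L where "L = P powr (1 / p) * S powr (1 - 1 / q)"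
        have L: "0 < L" using P S0 by (simp add: L_def)
        have scale: "f y * c x y powr \<gamma> * g k x powr (q - 1)
            = L * (a y powr (1 / p) * b x powr (1 - 1 / q) * c x y powr \<gamma>)" for x y
        proof -
          have "a y powr (1 / p) = f y / P powr (1 / p)"
            using p P f_nonneg[of y] by (simp add: a_def powr_divide powr_powr)
          moreover have "b x powr (1 - 1 / q) = g k x powr (q - 1) / S powr (1 - 1 / q)"
            using q S0 by (simp add: b_def powr_divide powr_powr right_diff_distrib)
          ultimately show ?thesis using P S0 by (simp add: L_def)
        qed
        have "ennreal S = (\<integral>\<^sup>+x. ennreal (g k x powr q) \<partial>M)" by (simp add: S)
        also have "\<dots> \<le> (\<integral>\<^sup>+x. T x * ennreal (g k x powr (q - 1)) \<partial>M)"
        proof (intro nn_integral_mono)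
          fix x
          have "g k x powr q = g k x * g k x powr (q - 1)"
            using g_nonneg[of k x] q by (cases "g k x = 0") (auto simp: powr_diff)
          then have "ennreal (g k x powr q) = ennreal (g k x) * ennreal (g k x powr (q - 1))"
            by (simp add: ennreal_mult g_nonneg)
          then show "ennreal (g k x powr q) \<le> T x * ennreal (g k x powr (q - 1))"
            using mult_right_mono[OF g_le] by simp
        qed
        also have "\<dots> = (\<integral>\<^sup>+x. \<integral>\<^sup>+y. ennreal (f y * c x y powr \<gamma>) * ennreal (g k x powr (q - 1)) \<partial>M \<partial>M)"
          unfolding T_def by (intro nn_integral_cong nn_integral_multc[symmetric]) measurable
        also have "\<dots> = (\<integral>\<^sup>+x. \<integral>\<^sup>+y. ennreal L *
             ennreal (a y powr (1 / p) * b x powr (1 - 1 / q) * c x y powr \<gamma>) \<partial>M \<partial>M)"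
          using L by (simp add: ennreal_mult[symmetric] f_nonneg scale)
        also have "\<dots> = (\<integral>\<^sup>+x. ennreal L *
             (\<integral>\<^sup>+y. ennreal (a y powr (1 / p) * b x powr (1 - 1 / q) * c x y powr \<gamma>) \<partial>M) \<partial>M)"
          unfolding a_def b_def by (intro nn_integral_cong nn_integral_cmult) measurable
        also have "\<dots> = ennreal L * (\<integral>\<^sup>+x.
             (\<integral>\<^sup>+y. ennreal (a y powr (1 / p) * b x powr (1 - 1 / q) * c x y powr \<gamma>) \<partial>M) \<partial>M)"
          unfolding a_def b_def by (intro nn_integral_cmult) measurable
        also have "\<dots> \<le> ennreal L * ennreal E" by (intro mult_left_mono bil) auto
        finally have "S \<le> L * E" using L E by (simp add: ennreal_mult[symmetric])
        then have "S powr (1 / q) * S powr (1 - 1 / q) \<le> E * P powr (1 / p) * S powr (1 - 1 / q)"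
          using S0 by (simp add: L_def powr_add[symmetric] mult_ac)
        then have "S powr (1 / q) \<le> E * P powr (1 / p)" using S0 by simp
        then have "(S powr (1 / q)) powr q \<le> (E * P powr (1 / p)) powr q"
          using q by (intro powr_mono2) auto
        then have "S \<le> K" using S0 q E P by (simp add: powr_powr powr_mult K_def)
        then show ?thesis using S by (simp add: ennreal_leI)
      qed
    qed
    have inc: "incseq (\<lambda>k x. ennreal (g k x powr q))"
    proof (intro incseq_SucI le_funI)
      fix k x
      have "enn2real (min (T x) (of_nat k)) \<le> enn2real (min (T x) (of_nat (Suc k)))"
        using min_fin[of x "Suc k"] by (intro enn2real_mono min.mono) (auto simp: ennreal_of_nat_eq_real_of_nat)
      moreover have "indicator (B k) x \<le> (indicator (B (Suc k)) x :: real)"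
        using incseq_SucD[OF B(4)] by (auto simp: indicator_def)
      ultimately have "g k x \<le> g (Suc k) x" unfolding g_def by (intro mult_mono) auto
      then show "ennreal (g k x powr q) \<le> ennreal (g (Suc k) x powr q)"
        using q g_nonneg by (intro ennreal_leI powr_mono2) auto
    qed
    define s where "s x = (SUP k. ennreal (g k x powr q))" for x
    have [measurable]: "s \<in> borel_measurable M" unfolding s_def by measurable
    have s_int: "(\<integral>\<^sup>+x. s x \<partial>M) \<le> ennreal K"
      unfolding s_def by (subst nn_integral_monotone_convergence_SUP[OF inc]) (auto intro: SUP_least gK)
    have in_B: "\<exists>k0. \<forall>k\<ge>k0. x \<in> B k" if x: "x \<in> space M" for x
    proof -
      obtain k0 where "x \<in> B k0" using B(2) x by blast
      then have "x \<in> B k" if "k0 \<le> k" for k using incseqD[OF B(4) that] by (rule subsetD[rotated])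
      then show ?thesis by blast
    qed
    have "AE x in M. s x \<noteq> \<infinity>"
      by (rule nn_integral_PInf_AE) (use s_int in \<open>auto simp: top_unique\<close>)
    \<comment> \<open>Where \<open>T\<close> is infinite, \<open>g k\<close> equals \<open>k\<close>
      for all large \<open>k\<close>, which forces \<open>s\<close> to be infinite; this happens on
      a null set only.\<close>
    then have fin: "AE x in M. T x < \<infinity>"
    proof (rule AE_mp, intro AE_I2 impI)
      fix x assume x: "x \<in> space M" and "s x \<noteq> \<infinity>"
      then obtain r where r: "0 \<le> r" "s x = ennreal r" by (cases "s x") auto
      obtain k0 where k0: "\<And>k. k \<ge> k0 \<Longrightarrow> x \<in> B k" using in_B[OF x] by blast
      obtain n :: nat where "r < real n" using reals_Archimedean2 by blast
      \<comment> \<open>The successor ensures \<open>1 \<le> k\<close>, hence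
        \<open>k \<le> k powr q\<close>.\<close>
      define k where "k = Suc (max n k0)"
      have k: "r < real k" "1 \<le> real k" "x \<in> B k" using \<open>r < real n\<close> k0 by (auto simp: k_def)
      show "T x < \<infinity>"
      proof (rule ccontr)
        assume "\<not> T x < \<infinity>"
        then have "g k x = real k" using k by (simp add: g_def less_top[symmetric] ennreal_of_nat_eq_real_of_nat)
        moreover have "ennreal (g k x powr q) \<le> s x" unfolding s_def by (rule SUP_upper) simp
        ultimately have "real k powr q \<le> r" using r by simp
        moreover have "real k powr 1 \<le> real k powr q" using k q by (intro powr_mono) auto
        ultimately show False using k by simp
      qed
    qed
    have "(\<integral>\<^sup>+x. ennreal (enn2real (T x) powr q) \<partial>M) \<le> (\<integral>\<^sup>+x. s x \<partial>M)"
    proof (rule nn_integral_mono)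
      fix x assume x: "x \<in> space M"
      show "ennreal (enn2real (T x) powr q) \<le> s x"
      \<comment> \<open>A finite value of \<open>T x\<close> is attained by \<open>g k x\<close> for
        large \<open>k\<close>; for an infinite one, \<open>enn2real\<close> gives 0.\<close>
      proof (cases "T x")
        case (real t)
        obtain k0 where k0: "\<And>k. k \<ge> k0 \<Longrightarrow> x \<in> B k" using in_B[OF x] by blast
        obtain n :: nat where "t < real n" using reals_Archimedean2 by blast
        define k where "k = max n k0"
        have "t \<le> real k" "x \<in> B k" using \<open>t < real n\<close> k0 by (auto simp: k_def)
        then have "g k x = t" using real by (simp add: g_def ennreal_of_nat_eq_real_of_nat min_absorb1 ennreal_leI)
        moreover have "ennreal (g k x powr q) \<le> s x" unfolding s_def by (rule SUP_upper) simp
        ultimately show ?thesis using real by simp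
      qed simp
    qed
    then have "(\<integral>\<^sup>+x. ennreal (enn2real (T x) powr q) \<partial>M) \<le> ennreal (E powr q * P powr (q / p))"
      using s_int by (simp add: K_def)
    with fin show "(AE x in M. (\<integral>\<^sup>+y. ennreal (f y * c x y powr \<gamma>) \<partial>M) < \<infinity>) \<and>
      (\<integral>\<^sup>+x. ennreal (enn2real (\<integral>\<^sup>+y. ennreal (f y * c x y powr \<gamma>) \<partial>M) powr q) \<partial>M)
        \<le> ennreal (E powr q * P powr (q / p))"
      by (simp add: T_def)
  qed
qed

section \<open>Volume preserving maps\<close>

text \<open>The change of variables formula of \<open>HOL-Analysis\<close> is stated for well-ordered index types
  only. A copy of the index type, well-ordered by an arbitrary enumeration, removes this restriction.\<close>

typedef 'a enumerated = "UNIV :: 'a set" by simp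

lemma bij_Abs_enumerated: "bij Abs_enumerated"
  by (metis Abs_enumerated_inverse Rep_enumerated_inverse UNIV_I bij_iff)

instance enumerated :: (finite) finite
proof
  have "UNIV = range (Abs_enumerated :: 'a \<Rightarrow> _)"
    using bij_Abs_enumerated by (auto simp: bij_def)
  then show "finite (UNIV :: 'a enumerated set)" by (metis finite finite_imageI)
qed

instantiation enumerated :: (finite) wellorder
begin

definition "enumeration = (SOME f :: 'a \<Rightarrow> nat. inj f)"

definition "x \<le> y \<longleftrightarrow> enumeration (Rep_enumerated x) \<le> enumeration (Rep_enumerated y)"

definition "x < y \<longleftrightarrow> enumeration (Rep_enumerated x) < enumeration (Rep_enumerated y)"

instance
proof
  have "\<exists>f :: 'a \<Rightarrow> nat. inj f" using finite_imp_inj_to_nat_seg[of "UNIV :: 'a set"] by auto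
  then have inj: "inj (enumeration :: 'a \<Rightarrow> nat)"
    unfolding enumeration_def by (rule someI_ex)
  fix x y z :: "'a enumerated" and P :: "'a enumerated \<Rightarrow> bool"
  show "x < y \<longleftrightarrow> x \<le> y \<and> \<not> y \<le> x" "x \<le> x" "x \<le> y \<or> y \<le> x"
    by (auto simp: less_eq_enumerated_def less_enumerated_def)
  show "x \<le> y \<Longrightarrow> y \<le> z \<Longrightarrow> x \<le> z" by (auto simp: less_eq_enumerated_def)
  show "x \<le> y \<Longrightarrow> y \<le> x \<Longrightarrow> x = y"
    using inj by (auto simp: less_eq_enumerated_def Rep_enumerated_inject dest!: antisym injD)
  assume step: "\<And>x. (\<And>y. y < x \<Longrightarrow> P y) \<Longrightarrow> P x"
  show "P x"
    by (induction x rule: measure_induct_rule[of "\<lambda>x. enumeration (Rep_enumerated x)"])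
      (rule step, simp add: less_enumerated_def)
qed

end

section \<open>Relabelling of coordinates, and determinants\<close>

definition vec_enum :: "'a^'n \<Rightarrow> 'a^'n enumerated" where
  "vec_enum x = (\<chi> i. x $ Rep_enumerated i)"

definition vec_unenum :: "'a^'n enumerated \<Rightarrow> 'a^'n" where
  "vec_unenum x = (\<chi> i. x $ Abs_enumerated i)"

lemma vec_enum_inverse [simp]: "vec_unenum (vec_enum x) = x" "vec_enum (vec_unenum y) = y"
  by (simp_all add: vec_enum_def vec_unenum_def vec_eq_iff Abs_enumerated_inverse Rep_enumerated_inverse)

lemma linear_vec_enum: "linear (vec_enum :: real^'n \<Rightarrow> _)" "linear (vec_unenum :: _ \<Rightarrow> real^'n)"
  by (auto simp: linear_iff vec_enum_def vec_unenum_def vec_eq_iff)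

lemma has_derivative_vec_enum:
  "((vec_enum :: real^'n \<Rightarrow> _) has_derivative vec_enum) F"
  "((vec_unenum :: _ \<Rightarrow> real^'n) has_derivative vec_unenum) F'"
  using linear_vec_enum by (auto intro!: bounded_linear_imp_has_derivative simp: linear_conv_bounded_linear)

lemma borel_measurable_vec_enum [measurable]:
  "(vec_enum :: real^'n \<Rightarrow> _) \<in> borel_measurable borel"
  "(vec_unenum :: _ \<Rightarrow> real^'n) \<in> borel_measurable borel"
  by (auto intro!: borel_measurable_continuous_onI linear_continuous_on
      simp: linear_vec_enum linear_conv_bounded_linear[symmetric])

lemma prod_Basis_cart: "(\<Prod>b\<in>Basis. (x :: real^'n) \<bullet> b) = (\<Prod>i\<in>UNIV. x $ i)"
proof -
  have "(\<Prod>i\<in>UNIV. x $ i) = (\<Prod>b\<in>range (\<lambda>i. axis i (1::real)). x \<bullet> b)"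
    by (subst prod.reindex) (auto simp: inj_on_def axis_eq_axis inner_axis)
  also have "range (\<lambda>i::'n. axis i (1::real)) = Basis" by (auto simp: Basis_vec_def)
  finally show ?thesis by simp
qed

text \<open>Relabelling permutes the side lengths of a box, and Lebesgue measure is determined by
  its values on boxes.\<close>

lemma distr_lborel_vec_unenum: "distr lborel borel vec_unenum = (lborel :: (real^'n) measure)"
proof (rule lborel_eqI[symmetric])
  fix l u :: "real^'n" assume le: "\<And>b. b \<in> Basis \<Longrightarrow> l \<bullet> b \<le> u \<bullet> b"
  have "l $ i \<le> u $ i" for i
    using le[of "axis i 1"] by (simp add: inner_axis)
  then have le': "vec_enum l \<bullet> b \<le> vec_enum u \<bullet> b" if "b \<in> Basis" for b
    using that by (auto simp: Basis_vec_def inner_axis vec_enum_def)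
  have "vec_unenum -` box l u = box (vec_enum l) (vec_enum u)"
    apply (auto simp: mem_box_cart vec_enum_def vec_unenum_def)
    apply (metis Rep_enumerated_inverse)+
    apply (metis Abs_enumerated_inverse UNIV_I)+
    done
  then have "emeasure (distr lborel borel vec_unenum) (box l u)
      = (\<Prod>b\<in>Basis. (vec_enum u - vec_enum l) \<bullet> b)"
    using le' by (simp add: emeasure_distr emeasure_lborel_box)
  also have "(\<Prod>b\<in>Basis. (vec_enum u - vec_enum l) \<bullet> b) = (\<Prod>b\<in>Basis. (u - l) \<bullet> b)"
    unfolding prod_Basis_cart
    by (rule prod.reindex_bij_witness[of _ Abs_enumerated Rep_enumerated])
      (auto simp: vec_enum_def Abs_enumerated_inverse Rep_enumerated_inverse)
  finally show "emeasure (distr lborel borel vec_unenum) (box l u) = (\<Prod>b\<in>Basis. (u - l) \<bullet> b)" .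
qed simp

text \<open>The determinant of a linear endomorphism, formed after relabelling: this is literally
  the Jacobian that arises when a map is transported to the enumerated index type.\<close>

definition ldet :: "(real^'n \<Rightarrow> real^'n) \<Rightarrow> real" where
  "ldet f = det (matrix (vec_enum \<circ> f \<circ> vec_unenum))"

lemma ldet_id: "ldet (\<lambda>x. x) = 1"
proof -
  have eq: "vec_enum \<circ> (\<lambda>x. x) \<circ> vec_unenum = id" by auto
  show ?thesis unfolding ldet_def eq by (simp add: matrix_id_mat_1)
qed

lemma ldet_compose:
  assumes "linear f" "linear g"
  shows "ldet (\<lambda>x. f (g x)) = ldet f * ldet g"
proof -
  have eq: "vec_enum \<circ> (\<lambda>x. f (g x)) \<circ> vec_unenum
    = (vec_enum \<circ> f \<circ> vec_unenum) \<circ> (vec_enum \<circ> g \<circ> vec_unenum)" by auto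
  show ?thesis
    unfolding ldet_def eq
    by (subst matrix_compose) (auto intro!: linear_compose assms linear_vec_enum simp: det_mul)
qed

section \<open>Invariance of Lebesgue measure under maps with Jacobian of modulus 1\<close>

text \<open>The preimage of a box under \<open>f\<close> is its image under \<open>g\<close>, and
  the change of variables formula gives that image the volume of the box.\<close>

lemma lborel_distr_volume_preserving_enum:
  fixes f g :: "real^'n::{finite,wellorder} \<Rightarrow> real^'n::_"
  assumes f: "continuous_on UNIV f" and inv: "\<And>x. f (g x) = x" "\<And>x. g (f x) = x"
    and g: "\<And>x. (g has_derivative g' x) (at x)" and det: "\<And>x. \<bar>det (matrix (g' x))\<bar> = 1"
  shows "distr lborel borel f = lborel"
proof (rule lborel_eqI[symmetric])
  fix l u :: "real^'n::_" assume le: "\<And>b. b \<in> Basis \<Longrightarrow> l \<bullet> b \<le> u \<bullet> b"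
  have [measurable]: "f \<in> borel_measurable borel" by (rule borel_measurable_continuous_onI[OF f])
  have inj: "inj_on g (box l u)" by (metis inj_on_def inv(1))
  have der: "(g has_derivative g' x) (at x within box l u)" for x
    using g has_derivative_at_withinI by blast
  have int: "(\<lambda>x. \<bar>det (matrix (g' x))\<bar>) integrable_on box l u"
    unfolding det by (simp add: integrable_on_const)
  have meas: "g ` box l u \<in> lmeasurable"
    by (subst measurable_differentiable_image_eq[OF _ der inj]) (auto intro: int)
  have eq: "f -` box l u = g ` box l u" using inv by (auto simp: image_iff) metis
  have "measure lebesgue (g ` box l u) = integral (box l u) (\<lambda>x. 1)"
    using measure_differentiable_image_eq[OF _ der inj int] by (simp add: det)
  also have "\<dots> = (\<Prod>b\<in>Basis. (u - l) \<bullet> b)"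
    using le by (simp add: lmeasure_integral[symmetric] measure_lborel_box)
  finally have "emeasure lebesgue (g ` box l u) = (\<Prod>b\<in>Basis. (u - l) \<bullet> b)"
    using meas by (simp add: emeasure_eq_measure2 fmeasurableD2)
  \<comment> \<open>The change of variables formula concerns \<open>lebesgue\<close>; the two
    measures agree here because the preimage is a Borel set.\<close>
  moreover have "emeasure lborel (f -` box l u) = emeasure lebesgue (f -` box l u)"
    using measurable_sets_borel[of f borel "box l u"] by (simp add: main_part_sets)
  ultimately show "emeasure (distr lborel borel f) (box l u) = (\<Prod>b\<in>Basis. (u - l) \<bullet> b)"
    by (simp add: emeasure_distr eq)
qed simp

text \<open>Apply the previous lemma to the conjugate of \<open>f\<close> by the relabelling and
  push the result forward along \<open>vec_unenum\<close>, which cancels the inner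
  \<open>vec_enum\<close>.\<close>

lemma lborel_distr_volume_preserving:
  fixes f g :: "real^'n \<Rightarrow> real^'n"
  assumes f: "continuous_on UNIV f" and inv: "\<And>x. f (g x) = x" "\<And>x. g (f x) = x"
    and g: "\<And>x. (g has_derivative g' x) (at x)" and det: "\<And>x. \<bar>ldet (g' x)\<bar> = 1"
  shows "distr lborel borel f = lborel"
proof -
  have [measurable]: "f \<in> borel_measurable borel" by (rule borel_measurable_continuous_onI[OF f])
  have cont: "continuous_on S vec_enum" "continuous_on T vec_unenum"
    for S :: "(real^'n) set" and T :: "(real^'n enumerated) set"
    by (auto intro!: linear_continuous_on simp: linear_vec_enum linear_conv_bounded_linear[symmetric])
  have "distr lborel borel (vec_enum \<circ> f \<circ> vec_unenum) = lborel"
  proof (rule lborel_distr_volume_preserving_enum)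
    show "continuous_on UNIV (vec_enum \<circ> f \<circ> vec_unenum)"
      by (intro continuous_on_compose cont continuous_on_subset[OF f]) auto
    show "((vec_enum \<circ> g \<circ> vec_unenum) has_derivative (vec_enum \<circ> g' (vec_unenum x) \<circ> vec_unenum)) (at x)" for x
      by (intro diff_chain_at has_derivative_vec_enum) (simp add: g)
    show "\<bar>det (matrix (vec_enum \<circ> g' (vec_unenum x) \<circ> vec_unenum))\<bar> = 1" for x
      using det[of "vec_unenum x"] by (simp add: ldet_def)
  qed (auto simp: inv)
  then have "distr lborel borel (vec_unenum :: _ \<Rightarrow> real^'n)
      = distr (distr lborel borel (vec_enum \<circ> f \<circ> vec_unenum)) borel vec_unenum"
    by simp
  also have "\<dots> = distr (distr lborel borel vec_unenum) borel f"
    by (simp add: distr_distr comp_def)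
  finally show ?thesis by (simp add: distr_lborel_vec_unenum)
qed

section \<open>Haar measure on a homogeneous group\<close>

lemma Ck_continuous:
  assumes "Ck k f"
  shows "continuous_on UNIV f"
proof (cases k)
  case 0
  then show ?thesis using assms by simp
next
  case (Suc n)
  then have "isCont f x" for x
    using assms differentiable_imp_continuous_within by auto
  then show ?thesis by (simp add: continuous_at_imp_continuous_on)
qed

lemma continuous_ldet:
  fixes D :: "'a::topological_space \<Rightarrow> real^'n \<Rightarrow> real^'n"
  assumes "\<And>v. continuous_on S (\<lambda>x. D x v)"
  shows "continuous_on S (\<lambda>x. ldet (D x))"
  unfolding ldet_def det_def matrix_def vec_enum_def
  using assms by (auto intro!: continuous_intros)


lemma haar_measure_sigma_finite:
  assumes "haar_measure G \<mu>"
  shows "sigma_finite_measure \<mu>"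
proof
  have sets: "sets \<mu> = sets borel" and fin: "\<And>K. compact K \<Longrightarrow> emeasure \<mu> K < \<infinity>"
    using assms by (auto simp: haar_measure_def)
  have "space \<mu> = UNIV" using sets_eq_imp_space_eq[OF sets] by simp
  then show "\<exists>A. countable A \<and> A \<subseteq> sets \<mu> \<and> \<Union> A = space \<mu> \<and> (\<forall>a\<in>A. emeasure \<mu> a \<noteq> \<infinity>)"
    using fin by (intro exI[of _ "range (\<lambda>n::nat. cball 0 (real n))"])
      (auto simp: sets less_top[symmetric] real_arch_simple intro: less_imp_neq)
qed

context homogeneous_group
begin

lemma in_carrier [simp]: "x \<in> carrier G"
  by (simp add: carrier_UNIV)

lemma mult_0 [simp]: "x \<otimes> 0 = x" "0 \<otimes> x = x"
  using r_one[OF in_carrier[of x]] l_one[OF in_carrier[of x]] unfolding one_eq_0 by auto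

lemma inv_mult_cancel [simp]: "inv x \<otimes> (x \<otimes> y) = y" "x \<otimes> (inv x \<otimes> y) = y"
  by (simp_all add: m_assoc[symmetric])

lemma continuous_on_mult [continuous_intros]:
  assumes "continuous_on S f" "continuous_on S g"
  shows "continuous_on S (\<lambda>x. f x \<otimes> g x)"
proof -
  have "continuous_on UNIV (\<lambda>z. fst z \<otimes> snd z)"
    using smooth_mult by (metis Ck_continuous smooth_def)
  then show ?thesis
    using continuous_on_compose2[of UNIV "\<lambda>z. fst z \<otimes> snd z" S "\<lambda>x. (f x, g x)"] assms
    by (auto intro: continuous_on_Pair)
qed

lemma continuous_on_inv [continuous_intros]:
  assumes "continuous_on S f"
  shows "continuous_on S (\<lambda>x. inv (f x))"
proof -
  have "continuous_on UNIV (\<lambda>z. inv z)"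
    using smooth_inv by (metis Ck_continuous smooth_def)
  then show ?thesis using assms by (auto intro: continuous_on_compose2)
qed

section \<open>The Jacobian of left translations\<close>

text \<open>The derivative at \<open>y\<close> of the left translation by \<open>x\<close>, taken as
  a partial derivative of the joint multiplication so that \<open>smooth_mult\<close> gives
  continuity in \<open>x\<close>.\<close>

definition translation_derivative :: "real^'n \<Rightarrow> real^'n \<Rightarrow> real^'n \<Rightarrow> real^'n" where
  "translation_derivative x y v = frechet_derivative (\<lambda>z. fst z \<otimes> snd z) (at (x, y)) (0, v)"

lemma has_derivative_translation:
  "((\<lambda>y. x \<otimes> y) has_derivative translation_derivative x y) (at y)"
proof -
  have "Ck (Suc 0) (\<lambda>z. fst z \<otimes> snd z)" using smooth_mult smooth_def by blast
  then have "((\<lambda>z. fst z \<otimes> snd z) has_derivative frechet_derivative (\<lambda>z. fst z \<otimes> snd z) (at (x, y))) (at (x, y))"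
    by (simp add: frechet_derivative_works)
  moreover have "((\<lambda>y. (x, y)) has_derivative (\<lambda>v. (0, v))) (at y)"
    by (auto intro!: derivative_eq_intros)
  ultimately have "((\<lambda>z. fst z \<otimes> snd z) \<circ> (\<lambda>y. (x, y)) has_derivative
      frechet_derivative (\<lambda>z. fst z \<otimes> snd z) (at (x, y)) \<circ> (\<lambda>v. (0, v))) (at y)"
    by (intro diff_chain_at)
  then show ?thesis by (simp add: comp_def translation_derivative_def[abs_def])
qed

lemma linear_translation_derivative: "linear (translation_derivative x y)"
  using has_derivative_translation has_derivative_linear by blast

text \<open>Chain rule at the identity for the composite of two left translations. It reduces
  Jacobians at arbitrary points to Jacobians at \<open>0\<close>.\<close>

lemma ldet_translation_derivative_mult:
  "ldet (translation_derivative (x \<otimes> y) 0) = ldet (translation_derivative x y) * ldet (translation_derivative y 0)"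
proof -
  have "((\<lambda>z. x \<otimes> z) \<circ> (\<lambda>z. y \<otimes> z) has_derivative
      translation_derivative x y \<circ> translation_derivative y 0) (at 0)"
    using has_derivative_translation[of x y]
    by (intro diff_chain_at has_derivative_translation) simp
  then have "((\<lambda>z. (x \<otimes> y) \<otimes> z) has_derivative
      (\<lambda>v. translation_derivative x y (translation_derivative y 0 v))) (at 0)"
    by (simp add: comp_def m_assoc)
  then have "translation_derivative (x \<otimes> y) 0 = (\<lambda>v. translation_derivative x y (translation_derivative y 0 v))"
    using has_derivative_translation has_derivative_unique by blast
  then show ?thesis by (simp add: ldet_compose linear_translation_derivative)
qed

lemma linear_dilation: "linear (dilation \<nu> r)"
  by (auto simp: linear_iff dilation_def vec_eq_iff algebra_simps)

lemma dilation_0 [simp]: "dilation \<nu> r 0 = 0"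
  using linear_dilation linear_0 by blast

lemma dilation_inverse [simp]:
  assumes "0 < r"
  shows "dilation \<nu> r (dilation \<nu> (1 / r) x) = x" "dilation \<nu> (1 / r) (dilation \<nu> r x) = x"
  using assms by (simp_all add: dilation_def vec_eq_iff powr_divide)

lemma has_derivative_dilation: "(dilation \<nu> r has_derivative dilation \<nu> r) F"
  using linear_dilation by (simp add: bounded_linear_imp_has_derivative linear_conv_bounded_linear)

lemma dilation_mult: "0 < r \<Longrightarrow> dilation \<nu> r (x \<otimes> y) = dilation \<nu> r x \<otimes> dilation \<nu> r y"
  using dilation_iso[of r] by (auto simp: iso_def hom_def)

text \<open>A dilation is an automorphism, so conjugating the translation by \<open>x\<close> with
  it gives the translation by the dilated point, and conjugation preserves determinants.\<close>

lemma ldet_translation_dilation: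
  assumes "0 < r"
  shows "ldet (translation_derivative (dilation \<nu> r x) 0) = ldet (translation_derivative x 0)"
proof -
  have "(dilation \<nu> r \<circ> (\<lambda>z. x \<otimes> z) \<circ> dilation \<nu> (1 / r) has_derivative
      dilation \<nu> r \<circ> translation_derivative x 0 \<circ> dilation \<nu> (1 / r)) (at 0)"
    using has_derivative_translation[of x 0] by (intro diff_chain_at has_derivative_dilation) simp
  moreover have "dilation \<nu> r \<circ> (\<lambda>z. x \<otimes> z) \<circ> dilation \<nu> (1 / r) = (\<lambda>z. dilation \<nu> r x \<otimes> z)"
    using assms by (auto simp: dilation_mult)
  ultimately have "((\<lambda>z. dilation \<nu> r x \<otimes> z) has_derivative
      (\<lambda>v. dilation \<nu> r (translation_derivative x 0 (dilation \<nu> (1 / r) v)))) (at 0)"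
    by (simp add: comp_def)
  then have "translation_derivative (dilation \<nu> r x) 0
      = (\<lambda>v. dilation \<nu> r (translation_derivative x 0 (dilation \<nu> (1 / r) v)))"
    by (rule has_derivative_unique[OF has_derivative_translation])
  moreover have "ldet (dilation \<nu> r) * ldet (dilation \<nu> (1 / r)) = 1"
    using assms by (simp add: ldet_compose[symmetric] linear_dilation ldet_id)
  moreover have "linear (\<lambda>v. translation_derivative x 0 (dilation \<nu> (1 / r) v))"
    using linear_compose[OF linear_dilation linear_translation_derivative] by (simp add: comp_def)
  ultimately show ?thesis
    by (simp add: ldet_compose[OF linear_dilation] ldet_compose[OF linear_translation_derivative linear_dilation])
qed

lemma tendsto_dilation_0: "((\<lambda>r. dilation \<nu> r x) \<longlongrightarrow> 0) (at_right 0)"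
proof (rule vec_tendstoI)
  fix i
  have "((\<lambda>r. r powr (\<nu> $ i) * x $ i) \<longlongrightarrow> 0 powr (\<nu> $ i) * x $ i) (at_right 0)"
    using weights_pos[of i]
    by (intro tendsto_intros tendsto_powr') (auto simp: eventually_at_right_less intro: eventually_at_right_less[THEN eventually_mono])
  then show "((\<lambda>r. dilation \<nu> r x $ i) \<longlongrightarrow> 0 $ i) (at_right 0)"
    using weights_pos[of i] by (simp add: dilation_def)
qed

text \<open>Letting the dilation parameter tend to 0 moves \<open>x\<close> to the identity element,
  whose translation is the identity map, while the Jacobian stays constant.\<close>

lemma ldet_translation_derivative_0: "ldet (translation_derivative x 0) = 1"
proof -
  have "Ck (Suc 0) (\<lambda>z. fst z \<otimes> snd z)" using smooth_mult smooth_def by blast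
  then have "continuous_on UNIV (\<lambda>z. frechet_derivative (\<lambda>z. fst z \<otimes> snd z) (at z) v)" for v
    unfolding Ck.simps by blast
  then have "continuous_on UNIV (\<lambda>x. translation_derivative x 0 v)" for v
    unfolding translation_derivative_def
    using continuous_on_compose2[of UNIV "\<lambda>z. frechet_derivative (\<lambda>z. fst z \<otimes> snd z) (at z) (0, v)" UNIV "\<lambda>x. (x, 0)"]
    by (simp add: continuous_on_Pair)
  then have "continuous_on UNIV (\<lambda>x. ldet (translation_derivative x 0))"
    by (rule continuous_ldet)
  then have "isCont (\<lambda>x. ldet (translation_derivative x 0)) 0"
    by (simp add: continuous_on_eq_continuous_at)
  then have "((\<lambda>r. ldet (translation_derivative (dilation \<nu> r x) 0)) \<longlongrightarrow> ldet (translation_derivative 0 0)) (at_right 0)"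
    using tendsto_dilation_0 isCont_tendsto_compose by blast
  then have "((\<lambda>r::real. ldet (translation_derivative x 0)) \<longlongrightarrow> ldet (translation_derivative 0 0)) (at_right 0)"
    by (rule Lim_transform_eventually)
      (auto simp: ldet_translation_dilation intro: eventually_at_right_less[THEN eventually_mono])
  then have "ldet (translation_derivative x 0) = ldet (translation_derivative 0 0)"
    by (simp add: tendsto_const_iff)
  also have "translation_derivative 0 0 = (\<lambda>v. v)"
  proof -
    show ?thesis
      using has_derivative_translation[of 0 0] has_derivative_unique[OF _ has_derivative_ident] by fastforce
  qed
  finally show ?thesis by (simp add: ldet_id)
qed

section \<open>Lebesgue measure as a Haar measure, and its scaling\<close>

lemma distr_lborel_translation: "distr lborel borel (\<lambda>y. x \<otimes> y) = lborel"
proof (rule lborel_distr_volume_preserving)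
  show "((\<lambda>y. inv x \<otimes> y) has_derivative translation_derivative (inv x) y) (at y)" for y
    by (rule has_derivative_translation)
  \<comment> \<open>By the chain rule this Jacobian is a quotient of two Jacobians at
    \<open>0\<close>, both equal to 1.\<close>
  show "\<bar>ldet (translation_derivative (inv x) y)\<bar> = 1" for y
    using ldet_translation_derivative_mult[of "inv x" y] by (simp add: ldet_translation_derivative_0)
qed (auto intro!: continuous_intros)

lemma measurable_translation [measurable]: "(\<lambda>y. x \<otimes> y) \<in> borel \<rightarrow>\<^sub>M borel"
  by (intro borel_measurable_continuous_onI continuous_intros)

lemma translation_image_eq: "(\<lambda>y. x \<otimes> y) ` S = (\<lambda>y. inv x \<otimes> y) -` S"
proof
  show "(\<lambda>y. inv x \<otimes> y) -` S \<subseteq> (\<lambda>y. x \<otimes> y) ` S"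
  proof
    fix y assume "y \<in> (\<lambda>y. inv x \<otimes> y) -` S"
    then show "y \<in> (\<lambda>y. x \<otimes> y) ` S" by (intro image_eqI[of _ _ "inv x \<otimes> y"]) auto
  qed
qed auto

lemma haar_measure_lborel: "haar_measure G lborel"
  unfolding haar_measure_def
proof (intro conjI ballI allI impI)
  fix x and S :: "(real^'n) set" assume "S \<in> sets lborel"
  then have "emeasure lborel S = emeasure (distr lborel borel (\<lambda>y. inv x \<otimes> y)) S"
    by (simp add: distr_lborel_translation)
  also have "\<dots> = emeasure lborel ((\<lambda>y. x \<otimes> y) ` S)"
    using \<open>S \<in> sets lborel\<close> by (simp add: emeasure_distr translation_image_eq)
  finally show "emeasure lborel ((\<lambda>y. x \<otimes> y) ` S) = emeasure lborel S" ..
qed (auto simp: emeasure_compact_finite[unfolded infinity_ennreal_def])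

lemma haar_measure_translation_vimage:
  assumes "haar_measure G \<mu>" "S \<in> sets borel"
  shows "emeasure \<mu> ((\<lambda>y. x \<otimes> y) -` S) = emeasure \<mu> S"
proof -
  have "(\<lambda>y. x \<otimes> y) -` S = (\<lambda>y. inv x \<otimes> y) ` S"
    by (simp add: translation_image_eq)
  then show ?thesis using assms unfolding haar_measure_def by simp
qed

lemma homogeneous_dim_pos: "0 < homogeneous_dim \<nu>"
  unfolding homogeneous_dim_def by (intro sum_pos) (auto simp: weights_pos)

lemma emeasure_lborel_dilation_vimage:
  assumes r: "0 < r" and S: "S \<in> sets borel"
  shows "emeasure lborel (dilation \<nu> r -` S) = ennreal (r powr - homogeneous_dim \<nu>) * emeasure lborel S"
proof -
  define c where "c b = r powr (\<nu> \<bullet> b)" for b :: "real^'n"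
  have [measurable]: "dilation \<nu> r \<in> borel \<rightarrow>\<^sub>M borel"
    by (intro borel_measurable_continuous_onI linear_continuous_on)
      (simp add: linear_dilation linear_conv_bounded_linear[symmetric])
  \<comment> \<open>The diagonal form required by \<open>lborel_affine_euclidean\<close>; the
    product of the entries \<open>c j\<close> is \<open>r\<close> to the sum of the weights.\<close>
  have dil: "dilation \<nu> r = (\<lambda>x. 0 + (\<Sum>j\<in>Basis. (c j * (x \<bullet> j)) *\<^sub>R j))"
  proof
    fix x
    have "dilation \<nu> r x \<bullet> b = c b * (x \<bullet> b)" if "b \<in> Basis" for b
      using that by (auto simp: Basis_vec_def dilation_def c_def inner_axis)
    then have "(\<Sum>j\<in>Basis. (dilation \<nu> r x \<bullet> j) *\<^sub>R j) = (\<Sum>j\<in>Basis. (c j * (x \<bullet> j)) *\<^sub>R j)"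
      by (intro sum.cong) auto
    then show "dilation \<nu> r x = 0 + (\<Sum>j\<in>Basis. (c j * (x \<bullet> j)) *\<^sub>R j)"
      by (simp add: euclidean_representation)
  qed
  have "(\<Prod>j\<in>Basis. \<bar>c j\<bar>) = (\<Prod>b\<in>Basis. (\<chi> i. r powr (\<nu> $ i)) \<bullet> b)"
    by (intro prod.cong) (auto simp: c_def Basis_vec_def inner_axis)
  also have "\<dots> = (\<Prod>i\<in>UNIV. r powr (\<nu> $ i))" by (simp add: prod_Basis_cart)
  also have "\<dots> = r powr homogeneous_dim \<nu>"
    using r by (simp add: homogeneous_dim_def powr_sum)
  finally have prod: "(\<Prod>j\<in>Basis. \<bar>c j\<bar>) = r powr homogeneous_dim \<nu>" .
  have "lborel = density (distr lborel borel (dilation \<nu> r)) (\<lambda>_. ennreal (r powr homogeneous_dim \<nu>))"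
    using lborel_affine_euclidean[of c 0] r unfolding dil prod by (simp add: c_def)
  then have "emeasure lborel S = emeasure (density (distr lborel borel (dilation \<nu> r)) (\<lambda>_. ennreal (r powr homogeneous_dim \<nu>))) S"
    by simp
  also have "\<dots> = ennreal (r powr homogeneous_dim \<nu>) * emeasure lborel (dilation \<nu> r -` S)"
    using S by (simp add: emeasure_density_const emeasure_distr)
  finally have "ennreal (r powr - homogeneous_dim \<nu>) * emeasure lborel S
      = (ennreal (r powr - homogeneous_dim \<nu>) * ennreal (r powr homogeneous_dim \<nu>)) * emeasure lborel (dilation \<nu> r -` S)"
    by (simp add: mult.assoc)
  also have "ennreal (r powr - homogeneous_dim \<nu>) * ennreal (r powr homogeneous_dim \<nu>) = 1"
    using r by (simp add: ennreal_mult[symmetric] powr_add[symmetric])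
  finally show ?thesis by simp
qed

end

section \<open>Quasi-norms and Riesz potentials\<close>

locale quasi_normed_group = homogeneous_group G \<nu> for G :: "(real^'n) monoid" (structure) and \<nu> +
  fixes N :: "real^'n \<Rightarrow> real"
  assumes quasi_norm: "homogeneous_quasi_norm G \<nu> N"
begin

lemma N_nonneg [simp]: "0 \<le> N x"
  and N_inv [simp]: "N (inv x) = N x"
  and N_dilation: "0 < r \<Longrightarrow> N (dilation \<nu> r x) = r * N x"
  and N_eq_0_iff: "N x = 0 \<longleftrightarrow> x = 0"
  using quasi_norm unfolding homogeneous_quasi_norm_def by metis+

text \<open>This makes the kernel symmetric, so that bounds on rows are also bounds on
  columns.\<close>

lemma N_inv_mult_commute: "N (inv y \<otimes> x) = N (inv x \<otimes> y)"
  using N_inv[of "inv x \<otimes> y"] by (simp add: inv_mult_group)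

lemma continuous_on_N [continuous_intros]: "continuous_on S f \<Longrightarrow> continuous_on S (\<lambda>x. N (f x))"
  using quasi_norm unfolding homogeneous_quasi_norm_def by (auto intro: continuous_on_compose2)

lemma N_measurable [measurable]: "N \<in> borel_measurable borel"
  using continuous_on_N[OF continuous_on_id, of UNIV] by (intro borel_measurable_continuous_onI) simp

section \<open>Compactness of quasi-balls and the quasi-triangle inequality\<close>

definition qball :: "real \<Rightarrow> (real^'n) set" where
  "qball r = {x. N x \<le> r}"

lemma qball_sets [measurable]: "qball r \<in> sets borel"
  unfolding qball_def by measurable

lemma qball_dilation: "0 < r \<Longrightarrow> qball r = dilation \<nu> (1 / r) -` qball 1"
  by (auto simp: qball_def N_dilation field_simps)

text \<open>\<open>N\<close> is at least some \<open>c > 0\<close> on the Euclidean unit sphere. A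
  point with Euclidean norm above 1 and \<open>N x \<le> 1\<close> is carried onto the sphere by a
  dilation with \<open>r \<le> 1\<close>; homogeneity then forces \<open>c \<le> r\<close>, which
  bounds every coordinate of \<open>x\<close>.\<close>

lemma bounded_qball: "bounded (qball 1)"
proof -
  obtain c where c: "0 < c" "\<And>x. norm x = 1 \<Longrightarrow> c \<le> N x"
  proof (cases "sphere (0 :: real^'n) 1 = {}")
    case True
    then show ?thesis by (intro that[of 1]) auto
  next
    case False
    then obtain y where y: "y \<in> sphere 0 1" "\<forall>x\<in>sphere 0 1. N y \<le> N x"
      using continuous_attains_inf[of "sphere 0 1" N] continuous_on_N[OF continuous_on_id] by auto
    then have "N y \<noteq> 0" by (auto simp: N_eq_0_iff)
    then show ?thesis using y N_nonneg[of y] by (intro that[of "N y"]) (auto simp: less_le)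
  qed
  define R where "R = Max (range (\<lambda>i. max 1 ((1 / c) powr (\<nu> $ i))))"
  have "norm x \<le> R * CARD('n) + 1" if x: "x \<in> qball 1" for x
  proof (cases "norm x \<le> 1")
    case True
    have "0 \<le> R" unfolding R_def by (subst Max_ge_iff) auto
    then show ?thesis using True by (simp add: add_increasing)
  next
    case False
    \<comment> \<open>The weights are positive, so \<open>0 powr (\<nu> $ i) = 0\<close> continues
      the dilations to \<open>r = 0\<close>, and the path runs from the origin to
      \<open>x\<close>.\<close>
    have cont: "continuous_on {0..1} (\<lambda>r. norm (dilation \<nu> r x))"
      unfolding dilation_def using weights_pos
      by (intro continuous_intros continuous_on_powr') (auto simp: less_imp_le)
    have "norm (dilation \<nu> 0 x) \<le> 1" "norm (dilation \<nu> 1 x) \<ge> 1"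
      using False weights_pos by (auto simp: dilation_def vec_eq_iff less_imp_neq[symmetric] zero_vec_def[symmetric])
    then obtain r where r: "0 \<le> r" "r \<le> 1" "norm (dilation \<nu> r x) = 1"
      using IVT'[OF _ _ _ cont] by auto
    have "r \<noteq> 0"
    proof
      assume "r = 0"
      then have "dilation \<nu> r x = 0" by (simp add: dilation_def vec_eq_iff)
      then show False using r by simp
    qed
    then have r0: "0 < r" using r by simp
    have "c \<le> r * N x" using c r r0 by (simp add: N_dilation[symmetric])
    also have "\<dots> \<le> r * 1" using x r by (intro mult_left_mono) (auto simp: qball_def)
    finally have cr: "c \<le> r" by simp
    have comp: "\<bar>x $ i\<bar> \<le> R" for i
    proof -
      have "\<bar>dilation \<nu> r x $ i\<bar> \<le> 1" using component_le_norm_cart[of "dilation \<nu> r x" i] r by simp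
      then have "\<bar>x $ i\<bar> \<le> (1 / r) powr (\<nu> $ i)"
        using r0 by (simp add: dilation_def abs_mult powr_divide field_simps)
      also have "\<dots> \<le> (1 / c) powr (\<nu> $ i)"
        using c cr r0 weights_pos[of i] by (intro powr_mono2) (auto simp: field_simps)
      also have "\<dots> \<le> max 1 ((1 / c) powr (\<nu> $ i))" by simp
      also have "\<dots> \<le> R" unfolding R_def by (rule Max_ge) auto
      finally show ?thesis .
    qed
    have "norm x \<le> (\<Sum>i\<in>UNIV. \<bar>x $ i\<bar>)" by (rule norm_le_l1_cart)
    also have "\<dots> \<le> (\<Sum>i\<in>(UNIV::'n set). R)" by (intro sum_mono comp)
    finally show ?thesis by (simp add: mult.commute)
  qed
  then show ?thesis unfolding bounded_iff by blast
qed

lemma compact_qball: "0 < r \<Longrightarrow> compact (qball r)"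
proof -
  assume r: "0 < r"
  have "closed (qball 1)" unfolding qball_def by (intro closed_Collect_le continuous_intros)
  then have "compact (qball 1)" using bounded_qball by (simp add: compact_eq_bounded_closed)
  moreover have "qball r = dilation \<nu> r ` qball 1"
    using r by (auto simp: qball_def N_dilation image_iff field_simps intro!: exI[of _ "dilation \<nu> (1 / r) _"])
  ultimately show ?thesis
    using linear_dilation by (auto intro!: compact_continuous_image linear_continuous_on
        simp: linear_conv_bounded_linear[symmetric])
qed

text \<open>Dilating by the inverse of the larger quasi-norm moves both points into
  \<open>qball 1\<close>; the continuous function \<open>N (x \<otimes> y)\<close> is bounded on the
  compact square of that ball.\<close>

lemma quasi_triangle: "\<exists>K\<ge>1. \<forall>x y. N (x \<otimes> y) \<le> K * max (N x) (N y)"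
proof -
  have "compact ((\<lambda>z. N (fst z \<otimes> snd z)) ` (qball 1 \<times> qball 1))"
    by (intro compact_continuous_image continuous_intros compact_Times compact_qball) auto
  then have "bounded ((\<lambda>z. N (fst z \<otimes> snd z)) ` (qball 1 \<times> qball 1))"
    by (rule compact_imp_bounded)
  then obtain K0 where "\<forall>w\<in>(\<lambda>z. N (fst z \<otimes> snd z)) ` (qball 1 \<times> qball 1). norm w \<le> K0"
    unfolding bounded_iff by blast
  then have K0: "N (x \<otimes> y) \<le> K0" if "x \<in> qball 1" "y \<in> qball 1" for x y
    using that by auto
  define K where "K = max 1 K0"
  have "N (x \<otimes> y) \<le> K * max (N x) (N y)" for x y
  proof (cases "max (N x) (N y) = 0")
    case True
    then have "N x = 0" "N y = 0" using N_nonneg[of x] N_nonneg[of y] by linarith+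
    then have "x = 0" "y = 0" by (simp_all add: N_eq_0_iff)
    then show ?thesis using \<open>N x = 0\<close> by simp
  next
    case False
    define s where "s = max (N x) (N y)"
    have s: "0 < s" "N x \<le> s" "N y \<le> s" using False N_nonneg[of x] by (auto simp: s_def less_le le_max_iff_disj)
    have "N (dilation \<nu> (1 / s) x \<otimes> dilation \<nu> (1 / s) y) \<le> K0"
      using s by (intro K0) (auto simp: qball_def N_dilation)
    then have "N (x \<otimes> y) \<le> K0 * s"
      using s by (simp add: dilation_mult[symmetric] N_dilation field_simps)
    also have "\<dots> \<le> K * s" using s by (intro mult_right_mono) (auto simp: K_def)
    finally show ?thesis by (simp add: s_def)
  qed
  moreover have "1 \<le> K" by (simp add: K_def)
  ultimately show ?thesis by blast
qed

text \<open>Both sides of the inequality come from the measure of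
  \<open>{(x, y). N x \<le> R \<and> N (x\<^sup>-\<^sup>1 y) \<le> r}\<close> under the product of two Haar measures, in the two orders
  of integration.\<close>

lemma haar_measure_compare:
  assumes \<mu>: "haar_measure G \<mu>" and \<mu>': "haar_measure G \<mu>'"
    and K: "1 \<le> K" "\<And>x y. N (x \<otimes> y) \<le> K * max (N x) (N y)"
  shows "emeasure \<mu> (qball R) * emeasure \<mu>' (qball r) \<le> emeasure \<mu>' (qball (K * max R r)) * emeasure \<mu> (qball r)"
proof -
  have sets [measurable_cong]: "sets \<mu> = sets borel" "sets \<mu>' = sets borel"
    using \<mu> \<mu>' by (auto simp: haar_measure_def)
  interpret \<mu>: sigma_finite_measure \<mu> by (rule haar_measure_sigma_finite[OF \<mu>])
  interpret \<mu>': sigma_finite_measure \<mu>' by (rule haar_measure_sigma_finite[OF \<mu>'])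
  interpret pair_sigma_finite \<mu> \<mu>' ..
  have [measurable]: "(\<lambda>z. N (inv (fst z) \<otimes> snd z)) \<in> borel_measurable (borel \<Otimes>\<^sub>M borel)"
    unfolding borel_prod by (intro borel_measurable_continuous_onI continuous_intros)
  have translate: "emeasure \<mu>0 {y. N (inv x \<otimes> y) \<le> r} = emeasure \<mu>0 (qball r)" if "haar_measure G \<mu>0" for x \<mu>0
    using haar_measure_translation_vimage[OF that qball_sets, of "inv x" r] by (simp add: qball_def vimage_def)
  have "emeasure \<mu> (qball R) * emeasure \<mu>' (qball r)
      = (\<integral>\<^sup>+x. emeasure \<mu>' (qball r) * indicator (qball R) x \<partial>\<mu>)"
    by (subst nn_integral_cmult_indicator) (auto simp: sets mult.commute)
  also have "\<dots> = (\<integral>\<^sup>+x. (\<integral>\<^sup>+y. indicator (qball R) x * indicator {y. N (inv x \<otimes> y) \<le> r} y \<partial>\<mu>') \<partial>\<mu>)"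
    by (intro nn_integral_cong) (simp add: nn_integral_cmult translate[OF \<mu>'] mult.commute)
  also have "\<dots> = (\<integral>\<^sup>+y. (\<integral>\<^sup>+x. indicator (qball R) x * indicator {y. N (inv x \<otimes> y) \<le> r} y \<partial>\<mu>) \<partial>\<mu>')"
  proof (rule Fubini'[symmetric])
    have "(\<lambda>z. indicator (qball R) (fst z) * indicator {..r} (N (inv (fst z) \<otimes> snd z)) :: ennreal)
        \<in> borel_measurable (\<mu> \<Otimes>\<^sub>M \<mu>')"
      by measurable
    then show "(\<lambda>(x, y). indicator (qball R) x * indicator {y. N (inv x \<otimes> y) \<le> r} y :: ennreal)
        \<in> borel_measurable (\<mu> \<Otimes>\<^sub>M \<mu>')"
      by (simp add: indicator_def case_prod_beta)
  qed
  \<comment> \<open>The quasi-triangle inequality confines \<open>y\<close>; the condition on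
    \<open>x\<close> is then dropped, and symmetry turns the remaining set of \<open>x\<close> into
    a left translate of \<open>qball r\<close>.\<close>
  also have "\<dots> \<le> (\<integral>\<^sup>+y. (\<integral>\<^sup>+x. indicator (qball (K * max R r)) y * indicator {x. N (inv y \<otimes> x) \<le> r} x \<partial>\<mu>) \<partial>\<mu>')"
  proof (intro nn_integral_mono)
    fix x y
    have "N y \<le> K * max R r" if "N x \<le> R" "N (inv x \<otimes> y) \<le> r"
    proof -
      have "N y \<le> K * max (N x) (N (inv x \<otimes> y))" using K(2)[of x "inv x \<otimes> y"] by simp
      also have "\<dots> \<le> K * max R r" using that K(1) by (intro mult_left_mono) auto
      finally show ?thesis .
    qed
    then show "indicator (qball R) x * indicator {y. N (inv x \<otimes> y) \<le> r} y
        \<le> (indicator (qball (K * max R r)) y * indicator {x. N (inv y \<otimes> x) \<le> r} x :: ennreal)"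
      by (auto simp: indicator_def qball_def N_inv_mult_commute[of y x])
  qed
  also have "\<dots> = (\<integral>\<^sup>+y. emeasure \<mu> (qball r) * indicator (qball (K * max R r)) y \<partial>\<mu>')"
    by (intro nn_integral_cong) (simp add: nn_integral_cmult translate[OF \<mu>] mult.commute)
  also have "\<dots> = emeasure \<mu>' (qball (K * max R r)) * emeasure \<mu> (qball r)"
    by (subst nn_integral_cmult_indicator) (auto simp: sets mult.commute)
  finally show ?thesis .
qed

section \<open>Growth of quasi-balls under an arbitrary Haar measure\<close>

text \<open>Compare with Lebesgue measure, under which \<open>qball r\<close> has volume exactly
  \<open>V * r powr Q\<close>. The comparison loses a factor \<open>K\<close> on the larger of the
  two radii 1 and \<open>r\<close>, so the two measures exchange roles at \<open>r = 1\<close>: the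
  enlarged ball is \<open>qball K\<close> for \<open>\<mu>\<close> if \<open>r \<le> 1\<close>, and
  \<open>qball (K * r)\<close> for Lebesgue measure if \<open>r \<ge> 1\<close>.\<close>

lemma haar_measure_qball_le:
  assumes \<mu>: "haar_measure G \<mu>"
  obtains A where "0 \<le> A" "\<And>r. 0 < r \<Longrightarrow> emeasure \<mu> (qball r) \<le> ennreal (A * r powr homogeneous_dim \<nu>)"
proof -
  let ?Q = "homogeneous_dim \<nu>"
  obtain K where K: "1 \<le> K" "\<And>x y. N (x \<otimes> y) \<le> K * max (N x) (N y)"
    using quasi_triangle by blast
  have fin: "emeasure \<mu>0 (qball r) < \<infinity>" if "haar_measure G \<mu>0" "0 < r" for \<mu>0 r
    using that compact_qball by (auto simp: haar_measure_def)
  obtain V where V: "emeasure lborel (qball 1) = ennreal V" "0 \<le> V"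
    using fin[OF haar_measure_lborel, of 1] by (cases "emeasure lborel (qball 1)") auto
  have lb: "emeasure lborel (qball r) = ennreal (r powr ?Q * V)" if "0 < r" for r
    using that emeasure_lborel_dilation_vimage[of "1 / r" "qball 1"]
    by (simp add: qball_dilation[of r] V ennreal_mult powr_divide powr_minus_divide)
  have "V \<noteq> 0"
  proof
    assume "V = 0"
    have op: "open {x. N x < 1}" by (intro open_Collect_less continuous_intros)
    moreover have "N 0 < 1" by (simp add: N_eq_0_iff[THEN iffD2])
    ultimately have "{x. N x < 1} \<notin> null_sets lborel" using open_not_negligible
      by (metis (mono_tags, lifting) empty_iff mem_Collect_eq negligible_iff_null_sets null_sets_completionI)
    moreover have "emeasure lborel {x. N x < 1} \<le> emeasure lborel (qball 1)"
      by (intro emeasure_mono) (auto simp: qball_def)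
    ultimately show False using V \<open>V = 0\<close> op by auto
  qed
  then have V0: "0 < V" using V by simp
  obtain M1 where M1: "emeasure \<mu> (qball 1) = ennreal M1" "0 \<le> M1"
    using fin[OF \<mu>, of 1] by (cases "emeasure \<mu> (qball 1)") auto
  obtain MK where MK: "emeasure \<mu> (qball K) = ennreal MK" "0 \<le> MK"
    using fin[OF \<mu>, of K] K by (cases "emeasure \<mu> (qball K)") auto
  have small: "emeasure \<mu> (qball r) \<le> ennreal (MK * r powr ?Q)" if r: "0 < r" "r \<le> 1" for r
  proof -
    obtain m where m: "emeasure \<mu> (qball r) = ennreal m" "0 \<le> m"
      using fin[OF \<mu>, of r] r by (cases "emeasure \<mu> (qball r)") auto
    have "ennreal V * ennreal m \<le> ennreal MK * ennreal (r powr ?Q * V)"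
      using haar_measure_compare[OF haar_measure_lborel \<mu> K, of 1 r] r
      by (simp add: max_absorb1 lb m V MK)
    then have "V * m \<le> V * (MK * r powr ?Q)" using V m MK by (simp add: ennreal_mult[symmetric] mult_ac)
    then show ?thesis using V0 m by (simp add: ennreal_leI)
  qed
  have large: "emeasure \<mu> (qball r) \<le> ennreal (K powr ?Q * M1 * r powr ?Q)" if r: "1 \<le> r" for r
  proof -
    obtain m where m: "emeasure \<mu> (qball r) = ennreal m" "0 \<le> m"
      using fin[OF \<mu>, of r] r by (cases "emeasure \<mu> (qball r)") auto
    have "ennreal m * ennreal V \<le> ennreal ((K * r) powr ?Q * V) * ennreal M1"
      using haar_measure_compare[OF \<mu> haar_measure_lborel K, of r 1] r K(1)
      by (simp add: max_absorb1 lb m V M1)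
    then have "V * m \<le> V * (K powr ?Q * M1 * r powr ?Q)" using V m M1 K r
      by (simp add: ennreal_mult[symmetric] powr_mult mult_ac)
    then show ?thesis using V0 m by (simp add: ennreal_leI)
  qed
  show thesis
  proof (rule that[of "MK + K powr ?Q * M1"])
    fix r :: real assume "0 < r"
    then consider "0 < r" "r \<le> 1" | "1 \<le> r" by linarith
    then show "emeasure \<mu> (qball r) \<le> ennreal ((MK + K powr ?Q * M1) * r powr ?Q)"
    proof cases
      case 1
      have "MK * r powr ?Q \<le> (MK + K powr ?Q * M1) * r powr ?Q" using M1 by (intro mult_right_mono) auto
      then show ?thesis using small[OF 1] by (meson ennreal_leI order_trans)
    next
      case 2
      have "K powr ?Q * M1 * r powr ?Q \<le> (MK + K powr ?Q * M1) * r powr ?Q" using MK by (intro mult_right_mono) auto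
      then show ?thesis using large[OF 2] by (meson ennreal_leI order_trans)
    qed
  qed (use M1 MK in auto)
qed

section \<open>The Hardy-Littlewood-Sobolev inequality\<close>

lemma riesz_potential_bound:
  assumes \<mu>: "haar_measure G \<mu>"
    and p: "1 < p" and q: "p < q"
    and l: "0 < l" "l < homogeneous_dim \<nu>"
    and pq: "1 / q = 1 / p + l / homogeneous_dim \<nu> - 1"
  shows "\<exists>C>0. \<forall>u \<in> Lp \<mu> p.
    (AE x in \<mu>. integrable \<mu> (riesz_integrand G N l u x)) \<and>
    riesz_potential G \<mu> N l u \<in> Lp \<mu> q \<and>
    Lp_norm \<mu> q (riesz_potential G \<mu> N l u) \<le> C * Lp_norm \<mu> p u"
proof -
  let ?Q = "homogeneous_dim \<nu>"
  have sets [measurable_cong]: "sets \<mu> = sets borel"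
    using \<mu> by (auto simp: haar_measure_def)
  have space: "space \<mu> = UNIV" using sets_eq_imp_space_eq[OF sets] by simp
  interpret \<mu>: sigma_finite_measure \<mu> by (rule haar_measure_sigma_finite[OF \<mu>])
  have [measurable]: "(\<lambda>z. N (inv (fst z) \<otimes> snd z)) \<in> borel_measurable (borel \<Otimes>\<^sub>M borel)"
    unfolding borel_prod by (intro borel_measurable_continuous_onI continuous_intros)
  obtain A where A: "0 \<le> A" "\<And>r. 0 < r \<Longrightarrow> emeasure \<mu> (qball r) \<le> ennreal (A * r powr ?Q)"
    using haar_measure_qball_le[OF \<mu>] by blast
  \<comment> \<open>On the diagonal \<open>c x x = 0\<close>, as \<open>0 powr t = 0\<close>; this
    matches the integrand, where division by \<open>0 powr l = 0\<close> gives 0.\<close>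
  define c where "c x y = N (inv x \<otimes> y) powr - ?Q" for x y
  have c_meas: "(\<lambda>(x, y). c x y) \<in> borel_measurable (\<mu> \<Otimes>\<^sub>M \<mu>)"
    unfolding c_def case_prod_beta by measurable
  have row: "emeasure \<mu> {y \<in> space \<mu>. t \<le> c x y} \<le> ennreal (A / t)" if t: "0 < t" for x t
  proof -
    \<comment> \<open>\<open>t \<le> c x y\<close> bounds the quasi-norm by this radius, and a
      quasi-ball of radius \<open>r\<close> has measure at most
      \<open>A * r powr Q = A / t\<close>.\<close>
    define r where "r = t powr (- 1 / ?Q)"
    have "N (inv x \<otimes> y) \<le> r" if "t \<le> c x y" for y
    proof -
      have "N (inv x \<otimes> y) \<noteq> 0" using that t by (auto simp: c_def)
      then have "0 < N (inv x \<otimes> y)" using N_nonneg[of "inv x \<otimes> y"] by linarith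
      then have "N (inv x \<otimes> y) = c x y powr (- 1 / ?Q)"
        using homogeneous_dim_pos by (simp add: c_def powr_powr)
      also have "\<dots> \<le> r" unfolding r_def using that t homogeneous_dim_pos
        by (intro powr_mono2') auto
      finally show ?thesis .
    qed
    then have "{y \<in> space \<mu>. t \<le> c x y} \<subseteq> (\<lambda>y. inv x \<otimes> y) -` qball r"
      by (auto simp: qball_def)
    then have "emeasure \<mu> {y \<in> space \<mu>. t \<le> c x y} \<le> emeasure \<mu> ((\<lambda>y. inv x \<otimes> y) -` qball r)"
      using measurable_sets_borel[OF measurable_translation qball_sets] by (intro emeasure_mono) (auto simp: sets)
    also have "\<dots> = emeasure \<mu> (qball r)" by (rule haar_measure_translation_vimage[OF \<mu> qball_sets])
    also have "\<dots> \<le> ennreal (A * r powr ?Q)" using t by (intro A) (simp add: r_def)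
    also have "r powr ?Q = t powr - 1"
      using homogeneous_dim_pos by (simp add: r_def powr_powr)
    also have "A * t powr - 1 = A / t"
      using t by (simp add: powr_minus_divide)
    finally show ?thesis .
  qed
  have col: "emeasure \<mu> {x \<in> space \<mu>. t \<le> c x y} \<le> ennreal (A / t)" if t: "0 < t" for y t
    using row[OF t, of y] by (simp add: c_def N_inv_mult_commute[of _ y])
  have q1: "1 < q" using p q by simp
  obtain C where C: "0 \<le> C"
    and bound: "\<And>f P. f \<in> borel_measurable \<mu> \<Longrightarrow> (\<And>y. 0 \<le> f y) \<Longrightarrow> 0 < P \<Longrightarrow>
      (\<integral>\<^sup>+y. ennreal (f y powr p) \<partial>\<mu>) \<le> ennreal P \<Longrightarrow>
      (AE x in \<mu>. (\<integral>\<^sup>+y. ennreal (f y * c x y powr (l / ?Q)) \<partial>\<mu>) < \<infinity>) \<and>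
      (\<integral>\<^sup>+x. ennreal (enn2real (\<integral>\<^sup>+y. ennreal (f y * c x y powr (l / ?Q)) \<partial>\<mu>) powr q) \<partial>\<mu>)
        \<le> ennreal (C * P powr (q / p))"
  proof (rule weak_type_strong_bound[OF \<mu>.sigma_finite_measure_axioms c_meas _ A(1) row col p q1 _ pq])
    show "l / ?Q < 1" using l by simp
  qed (auto simp: c_def)
  show ?thesis
  \<comment> \<open>\<open>C\<close> may be 0; adding 1 makes the constant positive.\<close>
  proof (intro exI[of _ "(C + 1) powr (1 / q)"] conjI ballI)
    show "0 < (C + 1) powr (1 / q)" using C by simp
    fix u assume "u \<in> Lp \<mu> p"
    then have u [measurable]: "u \<in> borel_measurable \<mu>" and u_int: "integrable \<mu> (\<lambda>x. norm (u x) powr p)"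
      by (auto simp: Lp_def)
    define T where "T x = (\<integral>\<^sup>+y. ennreal (norm (u y) * c x y powr (l / ?Q)) \<partial>\<mu>)" for x
    define J where "J = (\<integral>x. norm (u x) powr p \<partial>\<mu>)"
    have J: "0 \<le> J" "(\<integral>\<^sup>+x. ennreal (norm (u x) powr p) \<partial>\<mu>) = ennreal J"
      unfolding J_def by (auto simp: nn_integral_eq_integral[OF u_int])
    have "(AE x in \<mu>. T x < \<infinity>) \<and>
        (\<integral>\<^sup>+x. ennreal (enn2real (T x) powr q) \<partial>\<mu>) \<le> ennreal (C * P powr (q / p))"
      if "0 < P" "J \<le> P" for P
      unfolding T_def by (rule bound) (use that in \<open>auto simp: J(2) ennreal_leI\<close>)
    \<comment> \<open>\<open>J\<close> may be 0 while \<open>bound\<close> asks for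
      \<open>P > 0\<close>; \<open>J + 1\<close> serves for the finiteness of
      \<open>T\<close>.\<close>
    from this[of "J + 1"] this have T: "AE x in \<mu>. T x < \<infinity>"
        "\<And>P. 0 < P \<Longrightarrow> J \<le> P \<Longrightarrow> (\<integral>\<^sup>+x. ennreal (enn2real (T x) powr q) \<partial>\<mu>) \<le> ennreal (C * P powr (q / p))"
      using J(1) by auto
    have integrand: "riesz_integrand G N l u x y = u y / complex_of_real (N (inv x \<otimes> y) powr l)" for x y
      by (simp add: riesz_integrand_def N_inv_mult_commute[of y x])
    have integrand_meas [measurable]: "(\<lambda>(x, y). riesz_integrand G N l u x y) \<in> borel_measurable (\<mu> \<Otimes>\<^sub>M \<mu>)"
      unfolding integrand case_prod_beta by measurable
    have norm_integrand: "norm (riesz_integrand G N l u x y) = norm (u y) * c x y powr (l / ?Q)" for x y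
    proof -
      have "c x y powr (l / ?Q) = N (inv x \<otimes> y) powr - l"
        using homogeneous_dim_pos by (simp add: c_def powr_powr)
      then show ?thesis by (simp add: integrand norm_divide powr_minus_divide)
    qed
    have integrable: "integrable \<mu> (riesz_integrand G N l u x)" if "T x < \<infinity>" for x
    proof (rule integrableI_bounded)
      show "riesz_integrand G N l u x \<in> borel_measurable \<mu>"
        using measurable_compose[OF measurable_Pair1' integrand_meas, of x] by (simp add: space)
      show "(\<integral>\<^sup>+y. ennreal (norm (riesz_integrand G N l u x y)) \<partial>\<mu>) < \<infinity>"
        using that by (simp add: norm_integrand T_def)
    qed
    then show "AE x in \<mu>. integrable \<mu> (riesz_integrand G N l u x)"
      using T(1) by auto
    define I where "I = riesz_potential G \<mu> N l u"
    have [measurable]: "I \<in> borel_measurable \<mu>"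
      unfolding I_def riesz_potential_def[abs_def] by measurable
    have I_le: "norm (I x) \<le> enn2real (T x)" if "T x < \<infinity>" for x
    proof -
      have "ennreal (norm (I x)) \<le> T x"
        using integral_norm_bound_ennreal[OF integrable[OF that]]
        by (simp add: I_def riesz_potential_def norm_integrand T_def)
      then have "enn2real (ennreal (norm (I x))) \<le> enn2real (T x)"
        using that by (intro enn2real_mono) auto
      then show ?thesis by simp
    qed
    have "(\<integral>\<^sup>+x. ennreal (norm (I x) powr q) \<partial>\<mu>) \<le> (\<integral>\<^sup>+x. ennreal (enn2real (T x) powr q) \<partial>\<mu>)"
      using T(1) q1 by (intro nn_integral_mono_AE) (auto intro!: ennreal_leI powr_mono2 I_le)
    then have I_bound: "(\<integral>\<^sup>+x. ennreal (norm (I x) powr q) \<partial>\<mu>) \<le> ennreal (C * P powr (q / p))"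
      if "0 < P" "J \<le> P" for P
      using T(2)[OF that] order_trans by blast
    have I_int: "integrable \<mu> (\<lambda>x. norm (I x) powr q)"
      using I_bound[of "J + 1"] J(1) by (intro integrableI_bounded) (auto intro: le_less_trans)
    then show "riesz_potential G \<mu> N l u \<in> Lp \<mu> q"
      by (simp add: Lp_def I_def[symmetric])
    define S where "S = (\<integral>x. norm (I x) powr q \<partial>\<mu>)"
    have S: "0 \<le> S" by (simp add: S_def)
    have S_le: "S \<le> C * P powr (q / p)" if "0 < P" "J \<le> P" for P
      using I_bound[OF that] C by (simp add: nn_integral_eq_integral[OF I_int] S_def)
    have "S \<le> (C + 1) * J powr (q / p)"
    proof (cases "J = 0")
      \<comment> \<open>The estimate holds for every \<open>P > 0\<close>; letting \<open>P\<close>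
        tend to 0 gives \<open>S \<le> 0\<close>.\<close>
      case True
      have "((\<lambda>P. C * P powr (q / p)) \<longlongrightarrow> C * 0 powr (q / p)) (at_right 0)"
        using p q by (intro tendsto_intros tendsto_powr') (auto intro: eventually_at_right_less[THEN eventually_mono])
      moreover have "\<forall>\<^sub>F P in at_right 0. S \<le> C * P powr (q / p)"
        using eventually_at_right_less[of "0::real"] by eventually_elim (rule S_le, auto simp: True)
      ultimately have "S \<le> C * 0 powr (q / p)" by (intro tendsto_lowerbound) auto
      then show ?thesis using True by simp
    next
      case False
      then have "S \<le> C * J powr (q / p)" using J(1) by (intro S_le) auto
      also have "\<dots> \<le> (C + 1) * J powr (q / p)" by (intro mult_right_mono) auto
      finally show ?thesis .
    qed
    then have "S powr (1 / q) \<le> ((C + 1) * J powr (q / p)) powr (1 / q)"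
      using S q1 by (intro powr_mono2) auto
    also have "\<dots> = (C + 1) powr (1 / q) * J powr (1 / p)"
      using C q1 by (simp add: powr_mult powr_powr)
    finally show "Lp_norm \<mu> q (riesz_potential G \<mu> N l u) \<le> (C + 1) powr (1 / q) * Lp_norm \<mu> p u"
      by (simp add: Lp_norm_def I_def[symmetric] S_def J_def)
  qed
qed

end

theorem theorem2p1:
  fixes G :: "(real^'n) monoid" and \<nu> :: "real^'n" and N :: "real^'n \<Rightarrow> real"
    and \<mu> :: "(real^'n) measure" and p q l :: real
  assumes "homogeneous_group G \<nu>"
    and "homogeneous_quasi_norm G \<nu> N"
    and "haar_measure G \<mu>"
    and "1 < p" and "p < q"
    and "0 < l" and "l < homogeneous_dim \<nu>"
    and "1 / q = 1 / p + l / homogeneous_dim \<nu> - 1"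
  shows "\<exists>C>0. \<forall>u \<in> Lp \<mu> p.
    (AE x in \<mu>. integrable \<mu> (riesz_integrand G N l u x)) \<and>
    riesz_potential G \<mu> N l u \<in> Lp \<mu> q \<and>
    Lp_norm \<mu> q (riesz_potential G \<mu> N l u) \<le> C * Lp_norm \<mu> p u"
proof -
  interpret quasi_normed_group G \<nu> N
    using assms(1,2) by (simp add: quasi_normed_group_def quasi_normed_group_axioms_def)
  show ?thesis using assms by (intro riesz_potential_bound)
qed

end
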